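(* Suppose $\mathcal{T}=(V,E)$ is a countably infinite rooted directed tree, $\boldsymbol\lambda=\{\lambda_v\}_{v\in V^\circ}\subseteq(0,\infty)$, and the weighted shift $S_{\boldsymbol\lambda}$ on $\mathcal{T}$ with weights $\boldsymbol\lambda$ is a bounded operator on $\ell^2(V)$. Then the following assertions hold: (i) $\ell^2(V)=\mathcal{N}(S_{\boldsymbol\lambda}^* )\oplus\bigvee_{n=1}^\infty S_{\boldsymbol\lambda}^n\big(\mathcal{N}(S_{\boldsymbol\lambda}^* )\big)$; (ii) if $S_{\boldsymbol\lambda}$ is injective, then $S_{\boldsymbol\lambda}^n\big(\mathcal{N}(S_{\boldsymbol\lambda}^* )\big)\cap S_{\boldsymbol\lambda}^m\big(\mathcal{N}(S_{\boldsymbol\lambda}^* )\big)=\{0\}$ for every $n,m\in\mathbb{N}_0$ such that $n\neq m$; (iii) if $S_{\boldsymbol\lambda}$ is locally power balanced, then $S_{\boldsymbol\lambda}^n\big(\mathcal{N}(S_{\boldsymbol\lambda}^* )\big)\perp S_{\boldsymbol\lambda}^m\big(\mathcal{N}(S_{\boldsymbol\lambda}^* )\big)$ for every $n,m\in\mathbb{N}_0$ such that $n\neq m$; (iv) if $S_{\boldsymbol\lambda}^n\big(\mathcal{N}(S_{\boldsymbol\lambda}^* )\big)\perp S_{\boldsymbol\lambda}^m\big(\mathcal{N}(S_{\boldsymbol\lambda}^* )\big)$ for every $n,m\in\mathbb{N}_0$ such that $n\neq m$, and $S_{\boldsymbol\lambda}$ is injective, then $S_{\boldsymbol\lambda}$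 is balanced.
   Context: $\mathbb{N}=\{1,2,\dots\}$, $\mathbb{N}_0=\mathbb{N}\cup\{0\}$. A directed tree $\mathcal{T}=(V,E)$ is a directed graph with nonempty vertex set $V$ and edge set $E\subseteq\{(u,v)\in V\times V\colon u\ne v\}$ which is connected (as an undirected graph), has no directed circuits, and in which every $v\in V$ has at most one parent, i.e. a vertex $\mathsf{par}(v)$ with $(\mathsf{par}(v),v)\in E$. Put $\mathsf{Chi}(u)=\{v\in V\colon (u,v)\in E\}$ (possibly empty). A root is a vertex without parent (unique if it exists, denoted $\mathsf{root}$); $\mathcal{T}$ is rooted if the root exists, and then $V^\circ=V\setminus\{\mathsf{root}\}$. For rooted $\mathcal{T}$ and $v\in V$, $|v|$ is the unique $k\in\mathbb{N}_0$ such that the $k$-fold iterate of $\mathsf{par}$ sends $v$ to $\mathsf{root}$. The weighted shift $S_{\boldsymbol\lambda}$ is given by $(S_{\boldsymbol\lambda}f)(v)=\lambda_v f(\mathsf{par}(v))$ for $v\in V^\circ$ and $(S_{\boldsymbol\lambda}f)(\mathsf{root})=0$, $f\in\ell^2(V)$; it is a bounded operator on $\ell^2(V)$ when $\sup_{v\in V}\sum_{u\in\mathsf{Chi}(v)}|\lambda_u|^2<\infty$. $e_u\in\ell^2(V)$ is the characteristic function of $\{u\}$. $S_{\boldsymbol\lambda}$ is balanced if $\|S_{\boldsymbol\lambda}e_u\|=\|S_{\boldsymbol\lambda}e_v\|$ for every $u,v\in V$ such that $|u|=|v|$. $S_{\boldsymbol\lambda}$ is locally power balanced if $\|S_{\boldsymbol\lambda}^ne_u\|=\|S_{\boldsymbol\lambda}^ne_v\|$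 for every $n\in\mathbb{N}$ and all $u,v\in V$ (in $V^\circ$) such that $\mathsf{par}(u)=\mathsf{par}(v)$. $\mathcal{N}(A)$ is the kernel of $A$; $\oplus$ denotes the orthogonal sum; $\bigvee_n X_n$ is the smallest closed linear subspace containing all the sets $X_n$. *)

theory Defs
  imports "HOL-Analysis.Analysis" "HOL-Library.Function_Algebras"
begin

section \<open>Directed trees\<close>

definition directed_tree :: "'a set \<Rightarrow> ('a \<times> 'a) set \<Rightarrow> bool" where
  "directed_tree V E \<longleftrightarrow>
     V \<noteq> {} \<and> E \<subseteq> {(u, v). u \<in> V \<and> v \<in> V \<and> u \<noteq> v} \<and>
     (\<forall>u\<in>V. \<forall>v\<in>V. (u, v) \<in> (E \<union> E\<inverse>)\<^sup>*) \<and>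
     acyclic E \<and>
     (\<forall>v\<in>V. \<forall>p q. (p, v) \<in> E \<longrightarrow> (q, v) \<in> E \<longrightarrow> p = q)"

text \<open>The value of \<open>par\<close> at a vertex without parent is unspecified.\<close>

definition par :: "('a \<times> 'a) set \<Rightarrow> 'a \<Rightarrow> 'a" where
  "par E v = (THE u. (u, v) \<in> E)"

definition is_tree_root :: "'a set \<Rightarrow> ('a \<times> 'a) set \<Rightarrow> 'a \<Rightarrow> bool" where
  "is_tree_root V E r \<longleftrightarrow> r \<in> V \<and> (\<nexists>u. (u, r) \<in> E)"

definition rooted :: "'a set \<Rightarrow> ('a \<times> 'a) set \<Rightarrow> bool" where
  "rooted V E \<longleftrightarrow> (\<exists>r. is_tree_root V E r)"

definition tree_root :: "'a set \<Rightarrow> ('a \<times> 'a) set \<Rightarrow> 'a" where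
  "tree_root V E = (THE r. is_tree_root V E r)"

definition nonroots :: "'a set \<Rightarrow> ('a \<times> 'a) set \<Rightarrow> 'a set" where
  "nonroots V E = V - {tree_root V E}"

text \<open>
  The number \<open>|v|\<close>. Iterating \<open>par\<close> from \<open>v\<close> makes sense only until the root is
  reached; the least \<open>k\<close> discards spurious later returns to the root, which are
  possible because \<open>par\<close> is unspecified there.
\<close>

definition depth :: "'a set \<Rightarrow> ('a \<times> 'a) set \<Rightarrow> 'a \<Rightarrow> nat" where
  "depth V E v = (LEAST k. (par E ^^ k) v = tree_root V E)"

section \<open>The complex Hilbert space of square-summable functions\<close>

text \<open>Elements are functions on the whole type that vanish outside \<open>V\<close>.\<close>

definition l2 :: "'a set \<Rightarrow> ('a \<Rightarrow> complex) set" where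
  "l2 V = {f. (\<forall>x. x \<notin> V \<longrightarrow> f x = 0) \<and> (\<lambda>x. (cmod (f x))\<^sup>2) summable_on V}"

definition l2_inner :: "'a set \<Rightarrow> ('a \<Rightarrow> complex) \<Rightarrow> ('a \<Rightarrow> complex) \<Rightarrow> complex" where
  "l2_inner V f g = (\<Sum>\<^sub>\<infinity>x\<in>V. f x * cnj (g x))"

definition l2_norm :: "'a set \<Rightarrow> ('a \<Rightarrow> complex) \<Rightarrow> real" where
  "l2_norm V f = sqrt (\<Sum>\<^sub>\<infinity>x\<in>V. (cmod (f x))\<^sup>2)"

definition l2_topology :: "'a set \<Rightarrow> ('a \<Rightarrow> complex) topology" where
  "l2_topology V = Metric_space.mtopology (l2 V) (\<lambda>f g. l2_norm V (f - g))"

definition closed_subspace :: "'a set \<Rightarrow> ('a \<Rightarrow> complex) set \<Rightarrow> bool" where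
  "closed_subspace V M \<longleftrightarrow>
     module.subspace (\<lambda>c f x. c * f x) M \<and> closedin (l2_topology V) M"

definition closed_span :: "'a set \<Rightarrow> ('a \<Rightarrow> complex) set \<Rightarrow> ('a \<Rightarrow> complex) set" where
  "closed_span V X = \<Inter>{M. closed_subspace V M \<and> X \<subseteq> M}"

definition orthogonal_sets ::
    "'a set \<Rightarrow> ('a \<Rightarrow> complex) set \<Rightarrow> ('a \<Rightarrow> complex) set \<Rightarrow> bool" where
  "orthogonal_sets V X Y \<longleftrightarrow> (\<forall>f\<in>X. \<forall>g\<in>Y. l2_inner V f g = 0)"

definition is_orthogonal_sum ::
    "'a set \<Rightarrow> ('a \<Rightarrow> complex) set \<Rightarrow> ('a \<Rightarrow> complex) set \<Rightarrow> ('a \<Rightarrow> complex) set \<Rightarrow> bool" where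
  "is_orthogonal_sum V H M N \<longleftrightarrow>
     closed_subspace V M \<and> closed_subspace V N \<and>
     orthogonal_sets V M N \<and> H = {f + g | f g. f \<in> M \<and> g \<in> N}"

lemma vector_space_complex_functions:
  "vector_space (\<lambda>(c::complex) (f::'a \<Rightarrow> complex) x. c * f x)"
  by unfold_locales (auto simp: fun_eq_iff algebra_simps)

lemma l2_triangle:
  assumes f: "f \<in> l2 V" and g: "g \<in> l2 V"
  shows "f + g \<in> l2 V" "l2_norm V (f + g) \<le> l2_norm V f + l2_norm V g"
proof -
  have part: "L2_set (\<lambda>x. cmod (h x)) F \<le> l2_norm V h"
    if "h \<in> l2 V" "finite F" "F \<subseteq> V" for h F
    unfolding L2_set_def l2_norm_def
    using that by (intro real_sqrt_le_mono finite_sum_le_infsum) (auto simp: l2_def)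
  let ?B = "l2_norm V f + l2_norm V g"
  have B0: "0 \<le> ?B"
    by (simp add: l2_norm_def infsum_nonneg)
  have bd: "(\<Sum>x\<in>F. (cmod ((f + g) x))\<^sup>2) \<le> ?B\<^sup>2" if F: "finite F" "F \<subseteq> V" for F
  proof -
    have "L2_set (\<lambda>x. cmod ((f + g) x)) F \<le> L2_set (\<lambda>x. cmod (f x) + cmod (g x)) F"
      by (intro L2_set_mono) (auto intro: norm_triangle_ineq)
    also have "\<dots> \<le> L2_set (\<lambda>x. cmod (f x)) F + L2_set (\<lambda>x. cmod (g x)) F"
      by (rule L2_set_triangle_ineq)
    also have "\<dots> \<le> ?B"
      by (intro add_mono part f g F)
    finally show ?thesis
      unfolding L2_set_def by (rule sqrt_le_D)
  qed
  have summ: "(\<lambda>x. (cmod ((f + g) x))\<^sup>2) summable_on V"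
    by (rule nonneg_bdd_above_summable_on) (use bd in \<open>auto intro!: bdd_aboveI\<close>)
  then show "f + g \<in> l2 V"
    using f g by (auto simp: l2_def)
  have "(\<Sum>\<^sub>\<infinity>x\<in>V. (cmod ((f + g) x))\<^sup>2) \<le> ?B\<^sup>2"
    using summ bd by (rule infsum_le_finite_sums)
  then show "l2_norm V (f + g) \<le> ?B"
    unfolding l2_norm_def[of V "f + g"] using B0 by (rule real_le_lsqrt[rotated 1])
qed

lemma Metric_space_l2: "Metric_space (l2 V) (\<lambda>f g. l2_norm V (f - g))"
proof
  fix f g h :: "'a \<Rightarrow> complex"
  have minus: "b - c \<in> l2 V" if "b \<in> l2 V" "c \<in> l2 V" for b c
    using l2_triangle(1)[of b V "- c"] that by (simp add: l2_def)
  show "0 \<le> l2_norm V (f - g)"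
    by (simp add: l2_norm_def infsum_nonneg)
  show "l2_norm V (f - g) = l2_norm V (g - f)"
    by (simp add: l2_norm_def norm_minus_commute)
  assume f: "f \<in> l2 V" and g: "g \<in> l2 V"
  show "l2_norm V (f - g) = 0 \<longleftrightarrow> f = g"
  proof
    assume "l2_norm V (f - g) = 0"
    then have "(\<Sum>\<^sub>\<infinity>x\<in>V. (cmod ((f - g) x))\<^sup>2) \<le> 0"
      by (simp add: l2_norm_def)
    moreover have "(\<lambda>x. (cmod ((f - g) x))\<^sup>2) summable_on V"
      using minus[OF f g] by (auto simp: l2_def)
    ultimately have "(cmod ((f - g) x))\<^sup>2 = 0" if "x \<in> V" for x
      using nonneg_infsum_le_0D[of "\<lambda>x. (cmod ((f - g) x))\<^sup>2" V x] that by simp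
    then show "f = g"
      using f g by (fastforce simp: l2_def fun_eq_iff)
  qed (simp add: l2_norm_def)
  assume h: "h \<in> l2 V"
  show "l2_norm V (f - h) \<le> l2_norm V (f - g) + l2_norm V (g - h)"
    using l2_triangle(2)[OF minus[OF f g] minus[OF g h]] by simp
qed

section \<open>Operators\<close>

definition bounded_operator ::
    "'a set \<Rightarrow> (('a \<Rightarrow> complex) \<Rightarrow> 'a \<Rightarrow> complex) \<Rightarrow> bool" where
  "bounded_operator V A \<longleftrightarrow>
     (\<forall>f\<in>l2 V. A f \<in> l2 V) \<and>
     (\<forall>f\<in>l2 V. \<forall>g\<in>l2 V. A (f + g) = A f + A g) \<and>
     (\<forall>c. \<forall>f\<in>l2 V. A (\<lambda>x. c * f x) = (\<lambda>x. c * A f x)) \<and>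
     (\<exists>C. \<forall>f\<in>l2 V. l2_norm V (A f) \<le> C * l2_norm V f)"

definition l2_adjoint ::
    "'a set \<Rightarrow> (('a \<Rightarrow> complex) \<Rightarrow> 'a \<Rightarrow> complex) \<Rightarrow> ('a \<Rightarrow> complex) \<Rightarrow> 'a \<Rightarrow> complex" where
  "l2_adjoint V A g =
     (THE h. h \<in> l2 V \<and> (\<forall>f\<in>l2 V. l2_inner V (A f) g = l2_inner V f h))"

definition l2_kernel ::
    "'a set \<Rightarrow> (('a \<Rightarrow> complex) \<Rightarrow> 'a \<Rightarrow> complex) \<Rightarrow> ('a \<Rightarrow> complex) set" where
  "l2_kernel V A = {f \<in> l2 V. A f = 0}"

section \<open>Weighted shifts\<close>

definition weighted_shift ::
    "'a set \<Rightarrow> ('a \<times> 'a) set \<Rightarrow> ('a \<Rightarrow> real) \<Rightarrow> ('a \<Rightarrow> complex) \<Rightarrow> 'a \<Rightarrow> complex" where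
  "weighted_shift V E lam f v =
     (if v \<in> nonroots V E then of_real (lam v) * f (par E v) else 0)"

definition basis_vec :: "'a \<Rightarrow> 'a \<Rightarrow> complex" where
  "basis_vec u = indicator {u}"

definition balanced :: "'a set \<Rightarrow> ('a \<times> 'a) set \<Rightarrow> ('a \<Rightarrow> real) \<Rightarrow> bool" where
  "balanced V E lam \<longleftrightarrow>
     (\<forall>u\<in>V. \<forall>v\<in>V. depth V E u = depth V E v \<longrightarrow>
        l2_norm V (weighted_shift V E lam (basis_vec u)) =
        l2_norm V (weighted_shift V E lam (basis_vec v)))"

definition locally_power_balanced ::
    "'a set \<Rightarrow> ('a \<times> 'a) set \<Rightarrow> ('a \<Rightarrow> real) \<Rightarrow> bool" where
  "locally_power_balanced V E lam \<longleftrightarrow>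
     (\<forall>n\<ge>1. \<forall>u\<in>nonroots V E. \<forall>v\<in>nonroots V E. par E u = par E v \<longrightarrow>
        l2_norm V ((weighted_shift V E lam ^^ n) (basis_vec u)) =
        l2_norm V ((weighted_shift V E lam ^^ n) (basis_vec v)))"

end

theory Submission
  imports Defs
begin

text \<open>
  The adjoint acts by summation over children, \<open>(S\<^sup>* g)(u) = \<Sum>\<^bsub>v \<in> Chi(u)\<^esub> \<lambda>\<^sub>v g(v)\<close>, so
  membership in \<open>N = ker S\<^sup>*\<close> is a separate linear condition on each set of children. The orthogonal
  projection \<open>Q\<close> along \<open>N\<close> is therefore explicit,
  \<open>(Q f)(v) = \<lambda>\<^sub>v (S\<^sup>* f)(par v) / \<parallel>S e\<^bsub>par v\<^esub>\<parallel>\<^sup>2\<close>, and no completeness argument is required.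
  Since \<open>Q e\<^sub>v\<close> is a multiple of \<open>S e\<^bsub>par v\<^esub>\<close>, induction on the tree places \<open>Q e\<^sub>v\<close> in the span of the
  \<open>S\<^sup>n N\<close>, \<open>n \<ge> 1\<close>, and (i) follows by density; (ii) is immediate from \<open>N \<bottom> ran S\<close>.

  The operator \<open>S\<^sup>*\<^sup>nS\<^sup>n\<close> is diagonal with entries \<open>\<parallel>S\<^sup>n e\<^sub>u\<parallel>\<^sup>2\<close>. If these are constant among
  siblings, they factor out of the sums over children defining \<open>N\<close>, which gives (iii). Conversely,
  orthogonality tested on siblings forces that constancy; then
  \<open>\<parallel>S\<^bsup>n+1\<^esup> e\<^bsub>par u\<^esub>\<parallel>\<^sup>2 = \<parallel>S e\<^bsub>par u\<^esub>\<parallel>\<^sup>2 \<parallel>S\<^sup>n e\<^sub>u\<parallel>\<^sup>2\<close>, and induction on depth shows that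
  \<open>\<parallel>S\<^sup>n e\<^sub>u\<parallel>\<close> depends only on \<open>n\<close> and \<open>|u|\<close>, which contains (iv).
\<close>

section \<open>The space of square-summable functions\<close>

lemma norm_mult_summable:
  fixes f g :: "'b \<Rightarrow> complex"
  assumes "(\<lambda>x. (cmod (f x))\<^sup>2) summable_on A" "(\<lambda>x. (cmod (g x))\<^sup>2) summable_on A"
  shows "(\<lambda>x. norm (f x * g x)) summable_on A"
proof (rule Infinite_Sum.abs_summable_on_comparison_test'[where g = "\<lambda>x. (cmod (f x))\<^sup>2 + (cmod (g x))\<^sup>2"])
  show "(\<lambda>x. (cmod (f x))\<^sup>2 + (cmod (g x))\<^sup>2) summable_on A"
    using assms by (rule summable_on_add)
  show "norm (f x * g x) \<le> (cmod (f x))\<^sup>2 + (cmod (g x))\<^sup>2" for x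
  proof -
    have "2 * (cmod (f x) * cmod (g x)) \<le> (cmod (f x))\<^sup>2 + (cmod (g x))\<^sup>2"
      using sum_squares_bound[of "cmod (f x)" "cmod (g x)"] by simp
    moreover have "0 \<le> cmod (f x) * cmod (g x)" by simp
    ultimately show ?thesis unfolding norm_mult by linarith
  qed
qed

text \<open>The finite inequality passes to the limit. The index set is arbitrary because the bound
  serves both \<open>V\<close> and single sets of children.\<close>

lemma Cauchy_Schwarz_infsum:
  fixes f g :: "'b \<Rightarrow> complex"
  assumes "(\<lambda>x. (cmod (f x))\<^sup>2) summable_on A" "(\<lambda>x. (cmod (g x))\<^sup>2) summable_on A"
  shows "cmod (\<Sum>\<^sub>\<infinity>x\<in>A. f x * g x) \<le>
    sqrt (\<Sum>\<^sub>\<infinity>x\<in>A. (cmod (f x))\<^sup>2) * sqrt (\<Sum>\<^sub>\<infinity>x\<in>A. (cmod (g x))\<^sup>2)"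
proof -
  have "cmod (\<Sum>\<^sub>\<infinity>x\<in>A. f x * g x) \<le> (\<Sum>\<^sub>\<infinity>x\<in>A. norm (f x * g x))"
    using norm_mult_summable[OF assms] by (rule norm_infsum_bound)
  also have "\<dots> \<le> sqrt (\<Sum>\<^sub>\<infinity>x\<in>A. (cmod (f x))\<^sup>2) * sqrt (\<Sum>\<^sub>\<infinity>x\<in>A. (cmod (g x))\<^sup>2)"
  proof (rule infsum_le_finite_sums[OF norm_mult_summable[OF assms]])
    fix F assume F: "finite F" "F \<subseteq> A"
    have "(\<Sum>x\<in>F. norm (f x * g x)) \<le> L2_set (\<lambda>x. cmod (f x)) F * L2_set (\<lambda>x. cmod (g x)) F"
      using L2_set_mult_ineq[of "\<lambda>x. cmod (f x)" "\<lambda>x. cmod (g x)" F] by (simp add: norm_mult)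
    also have "\<dots> \<le> sqrt (\<Sum>\<^sub>\<infinity>x\<in>A. (cmod (f x))\<^sup>2) * sqrt (\<Sum>\<^sub>\<infinity>x\<in>A. (cmod (g x))\<^sup>2)"
      unfolding L2_set_def using F assms
      by (intro mult_mono real_sqrt_le_mono finite_sum_le_infsum) (auto simp: sum_nonneg infsum_nonneg)
    finally show "(\<Sum>x\<in>F. norm (f x * g x)) \<le>
      sqrt (\<Sum>\<^sub>\<infinity>x\<in>A. (cmod (f x))\<^sup>2) * sqrt (\<Sum>\<^sub>\<infinity>x\<in>A. (cmod (g x))\<^sup>2)" .
  qed
  finally show ?thesis .
qed

lemma l2_summable: "f \<in> l2 V \<Longrightarrow> (\<lambda>x. (cmod (f x))\<^sup>2) summable_on V"
  by (simp add: l2_def)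

lemma l2_outside: "f \<in> l2 V \<Longrightarrow> x \<notin> V \<Longrightarrow> f x = 0"
  by (simp add: l2_def)

lemma l2_zero [simp]: "0 \<in> l2 V"
  by (simp add: l2_def)

lemma l2_scale: "f \<in> l2 V \<Longrightarrow> (\<lambda>x. c * f x) \<in> l2 V"
  by (auto simp: l2_def norm_mult power_mult_distrib intro: summable_on_cmult_right)

lemma l2_diff: "f \<in> l2 V \<Longrightarrow> g \<in> l2 V \<Longrightarrow> f - g \<in> l2 V"
  using l2_triangle(1)[of f V "- g"] by (simp add: l2_def)

lemma basis_vec_apply: "basis_vec u x = (if x = u then 1 else 0)"
  by (simp add: basis_vec_def)

lemma basis_vec_l2: "u \<in> V \<Longrightarrow> basis_vec u \<in> l2 V"
proof -
  have "(\<lambda>x. (cmod (basis_vec u x))\<^sup>2) summable_on V \<longleftrightarrow>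
      (\<lambda>x. (cmod (basis_vec u x))\<^sup>2) summable_on V \<inter> {u}"
    by (rule summable_on_cong_neutral) (auto simp: basis_vec_apply)
  then show "u \<in> V \<Longrightarrow> basis_vec u \<in> l2 V"
    by (auto simp: l2_def basis_vec_apply summable_on_finite)
qed

lemma l2_norm_nonneg [simp]: "0 \<le> l2_norm V f"
  by (simp add: l2_norm_def infsum_nonneg)

lemma l2_norm_power2: "(l2_norm V f)\<^sup>2 = (\<Sum>\<^sub>\<infinity>x\<in>V. (cmod (f x))\<^sup>2)"
  by (simp add: l2_norm_def infsum_nonneg)

lemma l2_inner_summable:
  assumes "f \<in> l2 V" "g \<in> l2 V"
  shows "(\<lambda>x. f x * cnj (g x)) summable_on V"
  using norm_mult_summable[of f V "\<lambda>x. cnj (g x)"] assms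
  by (simp add: l2_def summable_on_iff_abs_summable_on_complex)

lemma l2_inner_bound:
  assumes "f \<in> l2 V" "g \<in> l2 V"
  shows "cmod (l2_inner V f g) \<le> l2_norm V f * l2_norm V g"
  using Cauchy_Schwarz_infsum[of f V "\<lambda>x. cnj (g x)"] assms
  by (simp add: l2_inner_def l2_norm_def l2_def)

lemma l2_inner_cnj: "l2_inner V g f = cnj (l2_inner V f g)"
  by (simp add: l2_inner_def flip: infsum_cnj) (simp add: mult.commute)

lemma l2_inner_add_left:
  assumes "f \<in> l2 V" "g \<in> l2 V" "h \<in> l2 V"
  shows "l2_inner V (f + g) h = l2_inner V f h + l2_inner V g h"
  using infsum_add[OF l2_inner_summable[OF assms(1,3)] l2_inner_summable[OF assms(2,3)]]
  by (simp add: l2_inner_def algebra_simps)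

lemma l2_inner_scale_left: "l2_inner V (\<lambda>x. c * f x) h = c * l2_inner V f h"
  by (simp add: l2_inner_def mult.assoc infsum_cmult_right')

lemma l2_inner_add_right:
  assumes "f \<in> l2 V" "g \<in> l2 V" "h \<in> l2 V"
  shows "l2_inner V h (f + g) = l2_inner V h f + l2_inner V h g"
  using l2_inner_add_left[OF assms] by (metis l2_inner_cnj complex_cnj_add)

lemma l2_inner_zero_right: "l2_inner V h 0 = 0"
  by (simp add: l2_inner_def)

lemma l2_inner_diff_right:
  assumes "f \<in> l2 V" "g \<in> l2 V" "h \<in> l2 V"
  shows "l2_inner V h (f - g) = l2_inner V h f - l2_inner V h g"
  using l2_inner_add_right[OF l2_diff[OF assms(1,2)] assms(2,3)] by simp

lemma l2_inner_scale_right: "l2_inner V h (\<lambda>x. c * f x) = cnj c * l2_inner V h f"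
  by (metis l2_inner_cnj l2_inner_scale_left complex_cnj_mult)

lemma l2_inner_basis_vec:
  assumes "u \<in> V"
  shows "l2_inner V (basis_vec u) g = cnj (g u)"
proof -
  have "l2_inner V (basis_vec u) g = (\<Sum>\<^sub>\<infinity>x\<in>{u}. cnj (g x))"
    unfolding l2_inner_def using assms
    by (intro infsum_cong_neutral) (auto simp: basis_vec_apply)
  then show ?thesis by simp
qed

lemma l2_inner_self:
  assumes "f \<in> l2 V"
  shows "l2_inner V f f = of_real ((l2_norm V f)\<^sup>2)"
proof -
  have "((\<lambda>x. of_real ((cmod (f x))\<^sup>2) :: complex) has_sum of_real ((l2_norm V f)\<^sup>2)) V"
    unfolding l2_norm_power2 using l2_summable[OF assms]
    by (intro has_sum_of_real has_sum_infsum)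
  then show ?thesis
    unfolding l2_inner_def complex_norm_square[symmetric] by (rule infsumI)
qed

lemma l2_inner_self_eq_0:
  assumes "f \<in> l2 V" "l2_inner V f f = 0"
  shows "f = 0"
proof -
  have "l2_norm V (f - 0) = 0"
    using assms by (simp add: l2_inner_self)
  then show ?thesis
    using Metric_space.zero[OF Metric_space_l2, of f V 0] assms by simp
qed

section \<open>Closed subspaces and approximation by finitely supported functions\<close>

text \<open>Closedness gives each point of \<open>l2 V\<close> outside \<open>M\<close> a ball
  missing \<open>M\<close>; the contrapositive is an approximation criterion free of
  topology.\<close>

lemma closed_subspace_iff:
  "closed_subspace V M \<longleftrightarrow>
    0 \<in> M \<and> (\<forall>f\<in>M. \<forall>g\<in>M. f + g \<in> M) \<and> (\<forall>c. \<forall>f\<in>M. (\<lambda>x. c * f x) \<in> M) \<and> M \<subseteq> l2 V \<and>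
    (\<forall>f\<in>l2 V. (\<forall>e>0. \<exists>g\<in>M. l2_norm V (f - g) < e) \<longrightarrow> f \<in> M)"
proof -
  interpret vector_space "\<lambda>(c::complex) (f::'a \<Rightarrow> complex) x. c * f x"
    by (rule vector_space_complex_functions)
  interpret Metric_space "l2 V" "\<lambda>f g. l2_norm V (f - g)"
    by (rule Metric_space_l2)
  have "closedin (l2_topology V) M \<longleftrightarrow> M \<subseteq> l2 V \<and>
    (\<forall>f. f \<in> l2 V - M \<longrightarrow> (\<exists>r>0. \<forall>g\<in>M. g \<notin> mball f r))"
    unfolding l2_topology_def closedin_metric disjnt_iff by blast
  also have "\<dots> \<longleftrightarrow> M \<subseteq> l2 V \<and>
    (\<forall>f\<in>l2 V. (\<forall>e>0. \<exists>g\<in>M. l2_norm V (f - g) < e) \<longrightarrow> f \<in> M)"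
    unfolding in_mball by blast
  finally show ?thesis
    by (simp only: closed_subspace_def subspace_def conj_assoc)
qed

lemma closed_subspace_l2: "closed_subspace V (l2 V)"
  by (auto simp: closed_subspace_iff l2_scale l2_triangle)

lemma closed_subspace_Inter:
  assumes "\<M> \<noteq> {}" "\<And>M. M \<in> \<M> \<Longrightarrow> closed_subspace V M"
  shows "closed_subspace V (\<Inter>\<M>)"
proof -
  interpret vector_space "\<lambda>(c::complex) (f::'a \<Rightarrow> complex) x. c * f x"
    by (rule vector_space_complex_functions)
  show ?thesis
    using assms unfolding closed_subspace_def
    by (intro conjI subspace_Inter closedin_Inter) auto
qed

lemma closed_subspace_closed_span:
  assumes "X \<subseteq> l2 V"
  shows "closed_subspace V (closed_span V X)"
  unfolding closed_span_def
  by (rule closed_subspace_Inter) (use closed_subspace_l2 assms in auto)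

lemma closed_span_least: "closed_subspace V M \<Longrightarrow> X \<subseteq> M \<Longrightarrow> closed_span V X \<subseteq> M"
  by (auto simp: closed_span_def)

lemma closed_subspace_sum:
  assumes "closed_subspace V M" "\<And>i. i \<in> I \<Longrightarrow> f i \<in> M"
  shows "(\<Sum>i\<in>I. f i) \<in> M"
  using assms(2) 
  by (induction I rule: infinite_finite_induct)
    (use assms(1) in \<open>auto simp: closed_subspace_iff\<close>)

lemma closed_subspace_orthogonal_complement:
  assumes X: "X \<subseteq> l2 V"
  shows "closed_subspace V {g \<in> l2 V. \<forall>f\<in>X. l2_inner V f g = 0}"
  unfolding closed_subspace_iff
proof (intro conjI ballI allI impI)
  fix g assume g: "g \<in> l2 V"
    and approx: "\<forall>e>0. \<exists>h\<in>{g \<in> l2 V. \<forall>f\<in>X. l2_inner V f g = 0}. l2_norm V (g - h) < e"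
  have "l2_inner V f g = 0" if f: "f \<in> X" for f
  proof -
    have "cmod (l2_inner V f g) \<le> 0 + e" if "e > 0" for e
    proof -
      \<comment> \<open>Adding 1 keeps the divisor positive when \<open>f\<close> has norm
        0.\<close>
      have pos: "l2_norm V f + 1 > 0"
        using l2_norm_nonneg[of V f] by linarith
      obtain h where h: "h \<in> l2 V" "l2_inner V f h = 0" "l2_norm V (g - h) < e / (l2_norm V f + 1)"
        using approx[rule_format, of "e / (l2_norm V f + 1)"] f \<open>e > 0\<close> pos by auto
      have "l2_inner V f g = l2_inner V f (g - h)"
        using f X g h by (subst l2_inner_diff_right) auto
      then have "cmod (l2_inner V f g) \<le> l2_norm V f * l2_norm V (g - h)"
        using l2_inner_bound[of f V "g - h"] f X g h l2_diff by auto
      also have "\<dots> \<le> (l2_norm V f + 1) * (e / (l2_norm V f + 1))"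
        using h(3) by (intro mult_mono) auto
      finally show ?thesis
        using pos by simp
    qed
    then have "cmod (l2_inner V f g) \<le> 0"
      by (rule field_le_epsilon)
    then show ?thesis by simp
  qed
  with g show "g \<in> {g \<in> l2 V. \<forall>f\<in>X. l2_inner V f g = 0}" by simp
next
  show "0 \<in> {g \<in> l2 V. \<forall>f\<in>X. l2_inner V f g = 0}"
    by (simp add: l2_inner_def)
next
  fix g h assume "g \<in> {g \<in> l2 V. \<forall>f\<in>X. l2_inner V f g = 0}" "h \<in> {g \<in> l2 V. \<forall>f\<in>X. l2_inner V f g = 0}"
  then show "g + h \<in> {g \<in> l2 V. \<forall>f\<in>X. l2_inner V f g = 0}"
    using X by (simp add: l2_triangle l2_inner_add_right subset_iff)
next
  fix c g assume "g \<in> {g \<in> l2 V. \<forall>f\<in>X. l2_inner V f g = 0}"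
  then show "(\<lambda>x. c * g x) \<in> {g \<in> l2 V. \<forall>f\<in>X. l2_inner V f g = 0}"
    by (simp add: l2_scale l2_inner_scale_right)
qed auto

lemma l2_finite_approximation:
  assumes f: "f \<in> l2 V" and "e > 0"
  obtains F where "finite F" "F \<subseteq> V" "l2_norm V (f - (\<Sum>u\<in>F. (\<lambda>x. f u * basis_vec u x))) < e"
proof -
  let ?q = "\<lambda>x. (cmod (f x))\<^sup>2"
  \<comment> \<open>Half of \<open>e\<^sup>2\<close> turns the non-strict approximation bound into a
    strict one.\<close>
  obtain F where F: "finite F" "F \<subseteq> V" "dist (sum ?q F) (infsum ?q V) \<le> e\<^sup>2 / 2"
    using infsum_finite_approximation[OF l2_summable[OF f], of "e\<^sup>2 / 2"] \<open>e > 0\<close> by auto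
  have val: "(f - (\<Sum>u\<in>F. (\<lambda>x. f u * basis_vec u x))) x = (if x \<in> F then 0 else f x)" for x
  proof -
    have "(\<Sum>u\<in>F. (\<lambda>x. f u * basis_vec u x)) x = (\<Sum>u\<in>F. if u = x then f x else 0)"
      by (induction F rule: infinite_finite_induct) (auto simp: basis_vec_apply)
    then show ?thesis using F by simp
  qed
  have "(l2_norm V (f - (\<Sum>u\<in>F. (\<lambda>x. f u * basis_vec u x))))\<^sup>2 = (\<Sum>\<^sub>\<infinity>x\<in>V - F. ?q x)"
    unfolding l2_norm_power2 val by (rule infsum_cong_neutral) auto
  also have "\<dots> = infsum ?q V - infsum ?q F"
    using F l2_summable[OF f] by (intro infsum_Diff) auto
  also have "\<dots> \<le> e\<^sup>2 / 2"
    using F(3) unfolding dist_real_def infsum_finite[OF F(1)] by linarith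
  also have "\<dots> < e\<^sup>2"
    using \<open>e > 0\<close> by simp
  finally have "l2_norm V (f - (\<Sum>u\<in>F. (\<lambda>x. f u * basis_vec u x))) < e"
    using \<open>e > 0\<close> by (simp add: power2_less_imp_less)
  with F that show ?thesis by blast
qed

lemma closed_subspace_eq_l2:
  assumes M: "closed_subspace V M" and basis: "\<And>u. u \<in> V \<Longrightarrow> basis_vec u \<in> M"
  shows "M = l2 V"
proof
  show "M \<subseteq> l2 V"
    using M by (simp add: closed_subspace_iff)
  show "l2 V \<subseteq> M"
  proof
    fix f assume f: "f \<in> l2 V"
    have "\<exists>g\<in>M. l2_norm V (f - g) < e" if e: "e > 0" for e
    proof -
      obtain F where F: "F \<subseteq> V" "l2_norm V (f - (\<Sum>u\<in>F. (\<lambda>x. f u * basis_vec u x))) < e"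
        using l2_finite_approximation[OF f e] by blast
      moreover have "(\<Sum>u\<in>F. (\<lambda>x. f u * basis_vec u x)) \<in> M"
        using F basis M by (intro closed_subspace_sum[OF M]) (auto simp: closed_subspace_iff)
      ultimately show ?thesis by blast
    qed
    then show "f \<in> M"
      using M f unfolding closed_subspace_iff by blast
  qed
qed

section \<open>Rooted directed trees\<close>

locale rooted_tree =
  fixes V :: "'a set" and E :: "('a \<times> 'a) set"
  assumes tree: "directed_tree V E" and rooted: "rooted V E"
begin

text \<open>Defined through \<open>par\<close>, so the sets \<open>chi u\<close> are visibly
  disjoint and exhaust the nonroots; the root, where \<open>par\<close> is unspecified, is
  excluded.\<close>

definition chi :: "'a \<Rightarrow> 'a set" where
  "chi u = {v \<in> nonroots V E. par E v = u}"

lemma par_unique: "(u, v) \<in> E \<Longrightarrow> (w, v) \<in> E \<Longrightarrow> u = w"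
  using tree unfolding directed_tree_def by blast

lemma edge_vertices: "(u, v) \<in> E \<Longrightarrow> u \<in> V \<and> v \<in> V"
  using tree unfolding directed_tree_def by blast

lemma par_eq: "(u, v) \<in> E \<Longrightarrow> par E v = u"
  unfolding par_def by (rule the_equality) (auto dest: par_unique)

text \<open>Undirected walks from the root can be straightened: a backward step from
  \<open>y\<close> leads to the unique parent of \<open>y\<close>, which already precedes
  \<open>y\<close> on the directed path.\<close>

lemma reachable_from_root:
  assumes r: "is_tree_root V E r" and v: "v \<in> V"
  shows "(r, v) \<in> E\<^sup>*"
proof -
  have "(r, v) \<in> (E \<union> E\<inverse>)\<^sup>*"
    using tree r v by (auto simp: directed_tree_def is_tree_root_def)
  then show ?thesis
  proof (induction rule: rtrancl_induct)
    case (step y z)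
    show ?case
    proof (cases "(y, z) \<in> E")
      case True
      with step.IH show ?thesis by (rule rtrancl_into_rtrancl)
    next
      case False
      then have zy: "(z, y) \<in> E" using step.hyps by auto
      then have "y \<noteq> r" using r by (auto simp: is_tree_root_def)
      with step.IH obtain q where "(r, q) \<in> E\<^sup>*" "(q, y) \<in> E"
        by (metis rtranclE)
      with zy par_unique show ?thesis by metis
    qed
  qed simp
qed

text \<open>A nonempty directed path cannot end in a root, so reachability of one root from another
  forces equality and justifies the definite description.\<close>

lemma is_tree_root_tree_root: "is_tree_root V E (tree_root V E)"
proof -
  obtain r where r: "is_tree_root V E r"
    using rooted by (auto simp: rooted_def)
  have "s = r" if s: "is_tree_root V E s" for s
  proof -
    have "(r, s) \<in> E\<^sup>*"
      using reachable_from_root[OF r] s by (simp add: is_tree_root_def)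
    then show ?thesis
      using s by (metis is_tree_root_def rtranclE)
  qed
  with r show ?thesis
    unfolding tree_root_def by (rule theI)
qed

lemma tree_root_in: "tree_root V E \<in> V"
  using is_tree_root_tree_root by (simp add: is_tree_root_def)

lemma nonroots_subset: "nonroots V E \<subseteq> V"
  by (auto simp: nonroots_def)

lemma edge_nonroot: "(u, v) \<in> E \<Longrightarrow> v \<in> nonroots V E"
  using is_tree_root_tree_root edge_vertices by (auto simp: nonroots_def is_tree_root_def)

lemma par_edge: 
  assumes "v \<in> nonroots V E"
  shows "(par E v, v) \<in> E"
proof -
  have "(tree_root V E, v) \<in> E\<^sup>*" "v \<noteq> tree_root V E"
    using reachable_from_root[OF is_tree_root_tree_root] assms by (auto simp: nonroots_def)
  then obtain u where "(u, v) \<in> E"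
    by (metis rtranclE)
  then show ?thesis
    using par_eq by simp
qed

lemma par_in: "v \<in> nonroots V E \<Longrightarrow> par E v \<in> V"
  using par_edge edge_vertices by blast

lemma tree_induct [consumes 1, case_names root child]:
  assumes "v \<in> V" "P (tree_root V E)" "\<And>v. v \<in> nonroots V E \<Longrightarrow> P (par E v) \<Longrightarrow> P v"
  shows "P v"
  using reachable_from_root[OF is_tree_root_tree_root \<open>v \<in> V\<close>]
proof (induction rule: rtrancl_induct)
  case (step y z)
  then show ?case
    using assms(3)[of z] edge_nonroot par_eq by blast
qed (rule assms)

lemma depth_root: "depth V E (tree_root V E) = 0"
  by (simp add: depth_def)

lemma ex_depth: "v \<in> V \<Longrightarrow> \<exists>k. (par E ^^ k) v = tree_root V E"
proof (induction rule: tree_induct)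
  case root
  then show ?case by (intro exI[of _ 0]) simp
next
  case (child v)
  then obtain k where "(par E ^^ k) (par E v) = tree_root V E" by blast
  then show ?case
    by (intro exI[of _ "Suc k"]) (simp add: funpow_swap1)
qed

lemma depth_child:
  assumes "v \<in> nonroots V E"
  shows "depth V E v = Suc (depth V E (par E v))"
proof -
  obtain k where "(par E ^^ k) v = tree_root V E"
    using ex_depth assms nonroots_subset by blast
  moreover have "\<not> (par E ^^ 0) v = tree_root V E"
    using assms by (auto simp: nonroots_def)
  ultimately show ?thesis
    \<comment> \<open>Index 0 is not a candidate for a nonroot, so the least index drops by exactly
      one at the parent.\<close>
    unfolding depth_def by (subst Least_Suc) (simp_all add: funpow_swap1)
qed

lemma chi_subset: "chi u \<subseteq> nonroots V E"
  by (auto simp: chi_def)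

lemma chi_outside: "u \<notin> V \<Longrightarrow> chi u = {}"
  using par_in by (auto simp: chi_def)

text \<open>Each nonroot is a child of exactly one vertex. In this form, reindexing and Fubini for
  infinite sums do the regrouping by parent.\<close>

lemma bij_betw_chi: "bij_betw snd (Sigma V chi) (nonroots V E)"
  by (rule bij_betwI[where g = "\<lambda>v. (par E v, v)"]) (auto simp: chi_def par_in)

lemma infsum_chi:
  fixes F :: "'a \<Rightarrow> 'b::banach"
  assumes "F summable_on nonroots V E"
  shows "(\<Sum>\<^sub>\<infinity>v\<in>nonroots V E. F v) = (\<Sum>\<^sub>\<infinity>u\<in>V. \<Sum>\<^sub>\<infinity>v\<in>chi u. F v)"
    and "(\<lambda>u. \<Sum>\<^sub>\<infinity>v\<in>chi u. F v) summable_on V"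
proof -
  have "(\<lambda>x. F (snd x)) summable_on Sigma V chi"
    using assms by (simp add: summable_on_reindex_bij_betw[OF bij_betw_chi])
  then have s: "(\<lambda>(u, v). F v) summable_on Sigma V chi"
    by (simp add: case_prod_unfold)
  have "(\<Sum>\<^sub>\<infinity>v\<in>nonroots V E. F v) = (\<Sum>\<^sub>\<infinity>x\<in>Sigma V chi. F (snd x))"
    by (simp add: infsum_reindex_bij_betw[OF bij_betw_chi])
  also have "\<dots> = (\<Sum>\<^sub>\<infinity>u\<in>V. \<Sum>\<^sub>\<infinity>v\<in>chi u. F v)"
    using infsum_Sigma'_banach[OF s] by (simp add: case_prod_unfold)
  finally show "(\<Sum>\<^sub>\<infinity>v\<in>nonroots V E. F v) = (\<Sum>\<^sub>\<infinity>u\<in>V. \<Sum>\<^sub>\<infinity>v\<in>chi u. F v)" .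
  show "(\<lambda>u. \<Sum>\<^sub>\<infinity>v\<in>chi u. F v) summable_on V"
    using summable_on_Sigma_banach[OF s] by simp
qed

lemma summable_chiI:
  fixes F :: "'a \<Rightarrow> real"
  assumes "\<And>v. 0 \<le> F v" "\<And>u. u \<in> V \<Longrightarrow> F summable_on chi u"
    "(\<lambda>u. \<Sum>\<^sub>\<infinity>v\<in>chi u. F v) summable_on V"
  shows "F summable_on nonroots V E"
proof -
  have "(\<lambda>x. F (snd x)) summable_on Sigma V chi"
    using assms by (intro summable_on_SigmaI[where g = "\<lambda>u. \<Sum>\<^sub>\<infinity>v\<in>chi u. F v"]) auto
  then show ?thesis
    by (simp add: summable_on_reindex_bij_betw[OF bij_betw_chi])
qed

end

section \<open>Weighted shifts\<close>

locale tree_shift = rooted_tree +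
  fixes lam :: "'a \<Rightarrow> real"
  assumes lam_pos: "\<forall>v\<in>nonroots V E. 0 < lam v"
    and bounded: "bounded_operator V (weighted_shift V E lam)"
begin

abbreviation S :: "('a \<Rightarrow> complex) \<Rightarrow> 'a \<Rightarrow> complex" where
  "S \<equiv> weighted_shift V E lam"

lemma S_chi: "v \<in> chi u \<Longrightarrow> S f v = of_real (lam v) * f u"
  by (auto simp: chi_def weighted_shift_def)

lemma S_root: "v \<notin> nonroots V E \<Longrightarrow> S f v = 0"
  by (simp add: weighted_shift_def)

text \<open>Linearity is stated on all functions, not only on \<open>l2 V\<close>, because
  \<open>ran_proj\<close> feeds \<open>S\<close> functions that may fail to be
  square-summable.\<close>

lemma S_add: "S (f + g) = S f + S g"
  by (auto simp: weighted_shift_def fun_eq_iff algebra_simps)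

lemma S_scale: "S (\<lambda>x. c * f x) = (\<lambda>x. c * S f x)"
  by (auto simp: weighted_shift_def fun_eq_iff algebra_simps)

lemma S_0: "S 0 = 0"
  by (auto simp: weighted_shift_def fun_eq_iff)

lemma S_pow_add: "(S ^^ n) (f + g) = (S ^^ n) f + (S ^^ n) g"
  by (induction n) (simp_all only: funpow.simps comp_apply id_apply S_add)

lemma S_pow_scale: "(S ^^ n) (\<lambda>x. c * f x) = (\<lambda>x. c * (S ^^ n) f x)"
  by (induction n) (simp_all add: S_scale)

lemma S_pow_0: "(S ^^ n) 0 = 0"
  by (induction n) (simp_all only: funpow.simps comp_apply id_apply S_0)

lemma S_l2: "f \<in> l2 V \<Longrightarrow> S f \<in> l2 V"
  using bounded by (simp add: bounded_operator_def)

lemma S_pow_l2: "f \<in> l2 V \<Longrightarrow> (S ^^ n) f \<in> l2 V"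
  by (induction n) (simp_all add: S_l2)

lemma S_basis_vec: "S (basis_vec u) = (\<lambda>v. if v \<in> chi u then of_real (lam v) else 0)"
  by (auto simp: fun_eq_iff weighted_shift_def chi_def basis_vec_apply)

lemma
  assumes "u \<in> V"
  shows lam_summable: "(\<lambda>v. (lam v)\<^sup>2) summable_on chi u"
    and lam_infsum: "(\<Sum>\<^sub>\<infinity>v\<in>chi u. (lam v)\<^sup>2) = (l2_norm V (S (basis_vec u)))\<^sup>2"
proof -
  have sub: "chi u \<subseteq> V" using chi_subset nonroots_subset by blast
  have eq: "(\<lambda>v. (cmod (S (basis_vec u) v))\<^sup>2) = (\<lambda>v. if v \<in> chi u then (lam v)\<^sup>2 else 0)"
    by (auto simp: S_basis_vec fun_eq_iff)
  have "(\<lambda>v. (cmod (S (basis_vec u) v))\<^sup>2) summable_on V"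
    using assms by (intro l2_summable S_l2 basis_vec_l2)
  moreover have "(\<lambda>v. (lam v)\<^sup>2) summable_on chi u \<longleftrightarrow>
    (\<lambda>v. if v \<in> chi u then (lam v)\<^sup>2 else 0) summable_on V"
    by (rule summable_on_cong_neutral) (use sub in auto)
  ultimately show "(\<lambda>v. (lam v)\<^sup>2) summable_on chi u"
    by (simp only: eq)
  show "(\<Sum>\<^sub>\<infinity>v\<in>chi u. (lam v)\<^sup>2) = (l2_norm V (S (basis_vec u)))\<^sup>2"
    unfolding l2_norm_power2 eq by (rule infsum_cong_neutral) (use sub in auto)
qed

text \<open>Testing an operator bound \<open>C\<close> on unit vectors gives
  \<open>B = C\<^sup>2\<close>. Uniformity in \<open>u\<close> later bounds the adjoint and the
  diagonal entries \<open>sq_norm\<close>.\<close>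

lemma ex_lam_bound:
  obtains B where "0 \<le> B" "\<And>u. u \<in> V \<Longrightarrow> (\<Sum>\<^sub>\<infinity>v\<in>chi u. (lam v)\<^sup>2) \<le> B"
proof -
  have "\<exists>C. \<forall>f\<in>l2 V. l2_norm V (S f) \<le> C * l2_norm V f"
    using bounded unfolding bounded_operator_def by (elim conjE)
  then obtain C where C: "\<And>f. f \<in> l2 V \<Longrightarrow> l2_norm V (S f) \<le> C * l2_norm V f"
    by blast
  have "(\<Sum>\<^sub>\<infinity>v\<in>chi u. (lam v)\<^sup>2) \<le> C\<^sup>2" if u: "u \<in> V" for u
  proof -
    have "l2_inner V (basis_vec u) (basis_vec u) = 1"
      using u by (simp add: l2_inner_basis_vec basis_vec_apply)
    then have "(l2_norm V (basis_vec u))\<^sup>2 = 1"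
      using l2_inner_self[OF basis_vec_l2[OF u]] by (metis of_real_eq_1_iff)
    then have "l2_norm V (basis_vec u) = 1"
      using l2_norm_nonneg[of V "basis_vec u"] by (simp add: power2_eq_1_iff)
    then have "l2_norm V (S (basis_vec u)) \<le> C"
      using C[OF basis_vec_l2[OF u]] by simp
    then show ?thesis
      unfolding lam_infsum[OF u] by (intro power_mono) simp_all
  qed
  with that[of "C\<^sup>2"] show ?thesis by simp
qed

text \<open>All inner product computations reduce to this rearrangement along the sets of children;
  the weight \<open>a\<close> is \<open>1\<close> for the adjoint and \<open>\<parallel>S\<^sup>n e\<^sub>v\<parallel>\<^sup>2\<close> for \<open>S\<^sup>*\<^sup>nS\<^sup>n\<close>.\<close>

lemma weighted_inner_S:
  fixes a :: "'a \<Rightarrow> real"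
  assumes f: "f \<in> l2 V" and g: "g \<in> l2 V" and a: "\<And>v. v \<in> V \<Longrightarrow> \<bar>a v\<bar> \<le> K"
  shows "(\<Sum>\<^sub>\<infinity>v\<in>V. of_real (a v) * (S f v * cnj (g v))) =
    (\<Sum>\<^sub>\<infinity>u\<in>V. f u * (\<Sum>\<^sub>\<infinity>v\<in>chi u. of_real (a v * lam v) * cnj (g v)))"
proof -
  let ?F = "\<lambda>v. of_real (a v) * (S f v * cnj (g v))"
  have "(\<lambda>v. norm (S f v * cnj (g v))) summable_on V"
    using l2_summable[OF S_l2[OF f]] l2_summable[OF g] by (intro norm_mult_summable) simp_all
  then have "(\<lambda>v. K * norm (S f v * cnj (g v))) summable_on V"
    by (rule summable_on_cmult_right)
  then have "(\<lambda>v. norm (?F v)) summable_on V"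
    by (rule Infinite_Sum.abs_summable_on_comparison_test')
      (use a in \<open>auto simp: norm_mult intro!: mult_right_mono\<close>)
  then have "?F summable_on V"
    by (simp add: summable_on_iff_abs_summable_on_complex)
  then have s: "?F summable_on nonroots V E"
    using nonroots_subset by (rule summable_on_subset_banach)
  have "infsum ?F V = infsum ?F (nonroots V E)"
    by (rule infsum_cong_neutral) (use nonroots_subset S_root in auto)
  also have "\<dots> = (\<Sum>\<^sub>\<infinity>u\<in>V. infsum ?F (chi u))"
    by (rule infsum_chi[OF s])
  also have "\<dots> = (\<Sum>\<^sub>\<infinity>u\<in>V. f u * (\<Sum>\<^sub>\<infinity>v\<in>chi u. of_real (a v * lam v) * cnj (g v)))"
    unfolding infsum_cmult_right'[symmetric]
    by (intro infsum_cong) (simp add: S_chi mult_ac)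
  finally show ?thesis .
qed

section \<open>The adjoint\<close>

definition adj :: "('a \<Rightarrow> complex) \<Rightarrow> 'a \<Rightarrow> complex" where
  "adj g u = (\<Sum>\<^sub>\<infinity>v\<in>chi u. of_real (lam v) * g v)"

lemma chi_l2_summable: "g \<in> l2 V \<Longrightarrow> (\<lambda>v. (cmod (g v))\<^sup>2) summable_on chi u"
  using l2_summable summable_on_subset_banach chi_subset nonroots_subset by (metis subset_trans)

text \<open>Cauchy-Schwarz on one set of children. It also forces \<open>adj g u = 0\<close> where
  the sum of squared weights is 0, which settles the degenerate quotient in
  \<open>ran_proj\<close>.\<close>

lemma adj_bound:
  assumes "g \<in> l2 V" "u \<in> V"
  shows "(cmod (adj g u))\<^sup>2 \<le> (\<Sum>\<^sub>\<infinity>v\<in>chi u. (lam v)\<^sup>2) * (\<Sum>\<^sub>\<infinity>v\<in>chi u. (cmod (g v))\<^sup>2)"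
proof -
  let ?L = "\<Sum>\<^sub>\<infinity>v\<in>chi u. (lam v)\<^sup>2" and ?G = "\<Sum>\<^sub>\<infinity>v\<in>chi u. (cmod (g v))\<^sup>2"
  have "cmod (adj g u) \<le> sqrt ?L * sqrt ?G"
    using Cauchy_Schwarz_infsum[of "\<lambda>v. of_real (lam v)" "chi u" g] assms
    by (simp add: adj_def lam_summable chi_l2_summable)
  then have "(cmod (adj g u))\<^sup>2 \<le> (sqrt ?L * sqrt ?G)\<^sup>2"
    by (rule power_mono) simp
  also have "\<dots> = ?L * ?G"
    by (simp add: power_mult_distrib infsum_nonneg)
  finally show ?thesis .
qed

text \<open>Grouping by parent counts every vertex but the root once, so the inequality loses only
  the mass at the root.\<close>

lemma
  assumes "g \<in> l2 V"
  shows chi_norm_summable: "(\<lambda>u. \<Sum>\<^sub>\<infinity>v\<in>chi u. (cmod (g v))\<^sup>2) summable_on V"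
    and chi_norm_le: "(\<Sum>\<^sub>\<infinity>u\<in>V. \<Sum>\<^sub>\<infinity>v\<in>chi u. (cmod (g v))\<^sup>2) \<le> (l2_norm V g)\<^sup>2"
proof -
  have s: "(\<lambda>v. (cmod (g v))\<^sup>2) summable_on nonroots V E"
    using l2_summable[OF assms] nonroots_subset by (rule summable_on_subset_banach)
  show "(\<lambda>u. \<Sum>\<^sub>\<infinity>v\<in>chi u. (cmod (g v))\<^sup>2) summable_on V"
    using infsum_chi(2)[OF s] .
  show "(\<Sum>\<^sub>\<infinity>u\<in>V. \<Sum>\<^sub>\<infinity>v\<in>chi u. (cmod (g v))\<^sup>2) \<le> (l2_norm V g)\<^sup>2"
    unfolding l2_norm_power2 infsum_chi(1)[OF s, symmetric]
    using s l2_summable[OF assms] nonroots_subset by (intro infsum_mono2) auto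
qed

lemma adj_outside: "u \<notin> V \<Longrightarrow> adj g u = 0"
  by (simp add: adj_def chi_outside)

lemma adj_l2:
  assumes g: "g \<in> l2 V"
  shows "adj g \<in> l2 V"
proof -
  obtain B where B: "0 \<le> B" "\<And>u. u \<in> V \<Longrightarrow> (\<Sum>\<^sub>\<infinity>v\<in>chi u. (lam v)\<^sup>2) \<le> B"
    using ex_lam_bound by blast
  have "(\<lambda>u. (cmod (adj g u))\<^sup>2) summable_on V"
  proof (rule summable_on_comparison_test)
    show "(\<lambda>u. B * (\<Sum>\<^sub>\<infinity>v\<in>chi u. (cmod (g v))\<^sup>2)) summable_on V"
      using chi_norm_summable[OF g] by (rule summable_on_cmult_right)
    show "(cmod (adj g u))\<^sup>2 \<le> B * (\<Sum>\<^sub>\<infinity>v\<in>chi u. (cmod (g v))\<^sup>2)" if "u \<in> V" for u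
      using adj_bound[OF g that] B(2)[OF that]
      by (rule order_trans[OF _ mult_right_mono]) (simp add: infsum_nonneg)
  qed simp
  then show ?thesis
    by (simp add: l2_def adj_outside)
qed

lemma adj_summable: "g \<in> l2 V \<Longrightarrow> u \<in> V \<Longrightarrow> (\<lambda>v. of_real (lam v) * g v) summable_on chi u"
  unfolding summable_on_iff_abs_summable_on_complex
  by (intro norm_mult_summable) (simp_all add: lam_summable chi_l2_summable)

lemma adj_add:
  assumes "f \<in> l2 V" "g \<in> l2 V"
  shows "adj (f + g) = adj f + adj g"
proof
  fix u show "adj (f + g) u = (adj f + adj g) u"
    using infsum_add[OF adj_summable adj_summable, of f u g] assms
    by (cases "u \<in> V") (simp_all add: adj_outside, simp add: adj_def algebra_simps)
qed

lemma adj_scale: "adj (\<lambda>x. c * f x) = (\<lambda>u. c * adj f u)"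
  by (simp add: adj_def fun_eq_iff flip: infsum_cmult_right') (simp add: mult_ac)

lemma inner_S_eq_inner_adj:
  assumes f: "f \<in> l2 V" and g: "g \<in> l2 V"
  shows "l2_inner V (S f) g = l2_inner V f (adj g)"
  using weighted_inner_S[OF f g, of "\<lambda>_. 1" 1]
  by (simp add: l2_inner_def adj_def flip: infsum_cnj)

text \<open>The formula has the defining property, and pairing with basis vectors reads off each
  coordinate, so no other candidate exists.\<close>

lemma l2_adjoint_S:
  assumes g: "g \<in> l2 V"
  shows "l2_adjoint V S g = adj g"
  unfolding l2_adjoint_def
proof (rule the_equality)
  show "adj g \<in> l2 V \<and> (\<forall>f\<in>l2 V. l2_inner V (S f) g = l2_inner V f (adj g))"
    using adj_l2 inner_S_eq_inner_adj g by blast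
  fix h assume h: "h \<in> l2 V \<and> (\<forall>f\<in>l2 V. l2_inner V (S f) g = l2_inner V f h)"
  show "h = adj g"
  proof
    fix u show "h u = adj g u"
    proof (cases "u \<in> V")
      case True
      have "l2_inner V (basis_vec u) h = l2_inner V (basis_vec u) (adj g)"
        using h inner_S_eq_inner_adj[OF basis_vec_l2[OF True] g] basis_vec_l2[OF True] by auto
      with True show ?thesis by (simp add: l2_inner_basis_vec)
    next
      case False
      then show ?thesis using h l2_outside[of h V u] by (simp add: adj_outside)
    qed
  qed
qed

section \<open>The kernel of the adjoint\<close>

abbreviation N :: "('a \<Rightarrow> complex) set" where
  "N \<equiv> l2_kernel V (l2_adjoint V S)"

lemma N_iff: "g \<in> N \<longleftrightarrow> g \<in> l2 V \<and> adj g = 0"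
  by (auto simp: l2_kernel_def l2_adjoint_S)

lemma N_l2: "g \<in> N \<Longrightarrow> g \<in> l2 V"
  by (simp add: N_iff)

lemma N_0: "0 \<in> N"
  by (simp add: N_iff) (simp add: adj_def fun_eq_iff)

lemma inner_S_N:
  assumes "f \<in> l2 V" "g \<in> N"
  shows "l2_inner V (S f) g = 0"
proof -
  have "g \<in> l2 V" "adj g = 0"
    using assms(2) by (simp_all only: N_iff)
  then show ?thesis
    using inner_S_eq_inner_adj[OF assms(1), of g] by (simp only: l2_inner_zero_right)
qed

lemma inner_N_S: "f \<in> l2 V \<Longrightarrow> g \<in> N \<Longrightarrow> l2_inner V g (S f) = 0"
  using inner_S_N[of f g] l2_inner_cnj[of V g "S f"] by simp

text \<open>The kernel is the orthogonal complement of the range: if \<open>g\<close> is orthogonal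
  to \<open>S (adj g)\<close>, then \<open>adj g\<close> has norm 0.\<close>

lemma closed_subspace_N: "closed_subspace V N"
proof -
  have "N = {g \<in> l2 V. \<forall>f\<in>S ` l2 V. l2_inner V f g = 0}"
  proof (intro set_eqI iffI)
    fix g assume g: "g \<in> {g \<in> l2 V. \<forall>f\<in>S ` l2 V. l2_inner V f g = 0}"
    then have "l2_inner V (S (adj g)) g = 0"
      using adj_l2 by blast
    then have "adj g = 0"
      using g by (intro l2_inner_self_eq_0[OF adj_l2]) (simp_all add: inner_S_eq_inner_adj adj_l2)
    then show "g \<in> N"
      using g N_iff by blast
  qed (auto simp: inner_S_N N_l2)
  then show ?thesis
    by (rule ssubst) (rule closed_subspace_orthogonal_complement, use S_l2 in blast)
qed

text \<open>The root is nobody's child, so no sum in the adjoint sees it. This vector starts the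
  induction for (i) and is the test vector for (iv).\<close>

lemma basis_vec_root_N: "basis_vec (tree_root V E) \<in> N"
proof -
  have "adj (basis_vec (tree_root V E)) u = 0" for u
    unfolding adj_def
    by (rule infsum_0) (use chi_subset in \<open>auto simp: basis_vec_apply nonroots_def\<close>)
  then show ?thesis
    by (auto simp: N_iff basis_vec_l2 tree_root_in fun_eq_iff)
qed

lemma adj_basis_vec:
  assumes "v \<in> nonroots V E"
  shows "adj (basis_vec v) u = (if u = par E v then of_real (lam v) else 0)"
proof -
  have "adj (basis_vec v) u = (\<Sum>\<^sub>\<infinity>w\<in>chi u \<inter> {v}. of_real (lam w))"
    unfolding adj_def by (rule infsum_cong_neutral) (auto simp: basis_vec_apply)
  also have "\<dots> = (if u = par E v then of_real (lam v) else 0)"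
    using assms by (auto simp: chi_def)
  finally show ?thesis .
qed

section \<open>The orthogonal projection onto the closure of the range\<close>

text \<open>At a vertex without children the quotient is \<open>0 / 0 = 0\<close> and is never used.\<close>

definition ran_proj :: "('a \<Rightarrow> complex) \<Rightarrow> 'a \<Rightarrow> complex" where
  "ran_proj f = S (\<lambda>u. adj f u / of_real (\<Sum>\<^sub>\<infinity>v\<in>chi u. (lam v)\<^sup>2))"

lemma ran_proj_add: "f \<in> l2 V \<Longrightarrow> g \<in> l2 V \<Longrightarrow> ran_proj (f + g) = ran_proj f + ran_proj g"
  unfolding ran_proj_def S_add[symmetric]
  by (rule arg_cong[where f = S]) (simp add: adj_add fun_eq_iff add_divide_distrib)

lemma ran_proj_scale: "ran_proj (\<lambda>x. c * f x) = (\<lambda>x. c * ran_proj f x)"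
  unfolding ran_proj_def S_scale[symmetric] adj_scale by simp

text \<open>On \<open>chi u\<close> the map projects \<open>f\<close> onto the line spanned by
  \<open>lam\<close>. The quotient inside \<open>S\<close> need not lie in \<open>l2 V\<close>, so
  \<open>S_l2\<close> is replaced by bounds on each set of children.\<close>

lemma ran_proj_contraction:
  assumes f: "f \<in> l2 V"
  shows "ran_proj f \<in> l2 V" "l2_norm V (ran_proj f) \<le> l2_norm V f"
proof -
  let ?L = "\<lambda>u. \<Sum>\<^sub>\<infinity>v\<in>chi u. (lam v)\<^sup>2"
  let ?c = "\<lambda>u. adj f u / of_real (?L u)"
  let ?F = "\<lambda>v. (cmod (ran_proj f v))\<^sup>2"
  let ?G = "\<lambda>u. \<Sum>\<^sub>\<infinity>v\<in>chi u. (cmod (f v))\<^sup>2"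
  have F: "?F v = (lam v)\<^sup>2 * (cmod (?c u))\<^sup>2" if "v \<in> chi u" for u v
    unfolding ran_proj_def S_chi[OF that] norm_mult power_mult_distrib by simp
  have s: "?F summable_on chi u" if u: "u \<in> V" for u
    using summable_on_cmult_left[OF lam_summable[OF u], of "(cmod (?c u))\<^sup>2"]
    by (rule summable_on_cong[THEN iffD1, rotated]) (simp add: F)
  have le: "infsum ?F (chi u) \<le> ?G u" if u: "u \<in> V" for u
  proof -
    have "infsum ?F (chi u) = ?L u * (cmod (?c u))\<^sup>2"
      unfolding infsum_cmult_left'[symmetric] by (rule infsum_cong) (simp add: F)
    also have "\<dots> \<le> ?G u"
    proof (cases "?L u = 0")
      case False
      then have L: "?L u > 0"
        using infsum_nonneg[of "chi u" "\<lambda>v. (lam v)\<^sup>2"] by simp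
      then have "?L u * (cmod (?c u))\<^sup>2 = (cmod (adj f u))\<^sup>2 / ?L u"
        by (simp add: norm_divide power_divide power2_eq_square)
      also have "\<dots> \<le> ?G u"
        using adj_bound[OF f u] L by (simp add: divide_le_eq mult.commute)
      finally show ?thesis .
    qed (simp add: infsum_nonneg)
    finally show ?thesis .
  qed
  have sV: "(\<lambda>u. infsum ?F (chi u)) summable_on V"
    using chi_norm_summable[OF f] le
    by (rule summable_on_comparison_test) (assumption, intro infsum_nonneg zero_le_power2)
  have sF: "?F summable_on nonroots V E"
    by (rule summable_chiI) (use s sV in auto)
  have z: "?F v = 0" if "v \<notin> nonroots V E" for v
    using that by (simp add: ran_proj_def S_root)
  have "?F summable_on V \<longleftrightarrow> ?F summable_on nonroots V E"
    by (rule summable_on_cong_neutral) (use z nonroots_subset in auto)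
  then show "ran_proj f \<in> l2 V"
    using sF z nonroots_subset by (auto simp: l2_def)
  have "(l2_norm V (ran_proj f))\<^sup>2 = infsum ?F (nonroots V E)"
    unfolding l2_norm_power2 by (rule infsum_cong_neutral) (use z nonroots_subset in auto)
  also have "\<dots> = (\<Sum>\<^sub>\<infinity>u\<in>V. infsum ?F (chi u))"
    using sF by (rule infsum_chi)
  also have "\<dots> \<le> (\<Sum>\<^sub>\<infinity>u\<in>V. ?G u)"
    using sV chi_norm_summable[OF f] le by (rule infsum_mono)
  also have "\<dots> \<le> (l2_norm V f)\<^sup>2"
    using f by (rule chi_norm_le)
  finally show "l2_norm V (ran_proj f) \<le> l2_norm V f"
    by (rule power2_le_imp_le) simp
qed

text \<open>Applying \<open>adj\<close> to \<open>ran_proj f\<close> produces the sum of squared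
  weights, which cancels the denominator and leaves \<open>adj f\<close>.\<close>

lemma diff_ran_proj_N:
  assumes f: "f \<in> l2 V"
  shows "f - ran_proj f \<in> N"
proof -
  let ?L = "\<lambda>u. \<Sum>\<^sub>\<infinity>v\<in>chi u. (lam v)\<^sup>2"
  have Q: "ran_proj f \<in> l2 V"
    using f by (rule ran_proj_contraction)
  have "adj (ran_proj f) u = adj f u" if u: "u \<in> V" for u
  proof -
    have "adj (ran_proj f) u = (\<Sum>\<^sub>\<infinity>v\<in>chi u. of_real ((lam v)\<^sup>2) * (adj f u / of_real (?L u)))"
      unfolding adj_def[of "ran_proj f"]
      by (rule infsum_cong) (simp add: ran_proj_def S_chi power2_eq_square)
    also have "\<dots> = of_real (?L u) * (adj f u / of_real (?L u))"
      unfolding infsum_cmult_left'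
        infsumI[OF has_sum_of_real[OF has_sum_infsum[OF lam_summable[OF u]]]] by (rule refl)
    \<comment> \<open>For a zero denominator, \<open>adj_bound\<close> forces
      \<open>adj f u = 0\<close>, so the cancellation remains valid.\<close>
    also have "\<dots> = adj f u"
      using adj_bound[OF f u] by (cases "?L u = 0") auto
    finally show ?thesis .
  qed
  then have adjQ: "adj (ran_proj f) = adj f"
    by (metis adj_outside ext)
  have "adj (f - ran_proj f) + adj (ran_proj f) = adj f"
    using adj_add[OF l2_diff[OF f Q] Q] by simp
  then show ?thesis
    using l2_diff[OF f Q] by (simp only: adjQ N_iff add_eq_0_iff) simp
qed

lemma ran_proj_basis_vec:
  assumes v: "v \<in> nonroots V E"
  obtains c where "ran_proj (basis_vec v) = (\<lambda>x. c * S (basis_vec (par E v)) x)"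
proof
  show "ran_proj (basis_vec v) = (\<lambda>x. of_real (lam v) /
      of_real (\<Sum>\<^sub>\<infinity>v\<in>chi (par E v). (lam v)\<^sup>2) * S (basis_vec (par E v)) x)"
    unfolding ran_proj_def S_scale[symmetric]
    by (rule arg_cong[where f = S]) (auto simp: adj_basis_vec[OF v] basis_vec_apply)
qed

section \<open>Wandering subspaces\<close>

text \<open>By induction on the tree: \<open>e\<^sub>v\<close> differs from a multiple of \<open>S e\<^bsub>par v\<^esub>\<close> by an element
  of \<open>N\<close>.\<close>

lemma S_pow_basis_vec_in:
  assumes K: "closed_subspace V K" and NK: "(\<Union>n\<in>{1..}. (S ^^ n) ` N) \<subseteq> K"
    and u: "u \<in> V" and n: "1 \<le> n"
  shows "(S ^^ n) (basis_vec u) \<in> K"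
  using u n
proof (induction u arbitrary: n rule: tree_induct)
  case root
  then show ?case
    using NK basis_vec_root_N by auto
next
  case (child v)
  obtain c where c: "ran_proj (basis_vec v) = (\<lambda>x. c * S (basis_vec (par E v)) x)"
    using ran_proj_basis_vec[OF child.hyps] .
  let ?g = "basis_vec v - ran_proj (basis_vec v)"
  have "?g \<in> N"
    using child.hyps nonroots_subset by (intro diff_ran_proj_N basis_vec_l2) auto
  then have "(S ^^ n) ?g \<in> K"
    using NK child.prems by auto
  moreover have "(S ^^ n) (ran_proj (basis_vec v)) \<in> K"
  proof -
    \<comment> \<open>Passing to the parent costs one more power of \<open>S\<close>; hence the
      induction hypothesis is needed at \<open>Suc n\<close>.\<close>
    have "(S ^^ n) (ran_proj (basis_vec v)) = (\<lambda>x. c * (S ^^ Suc n) (basis_vec (par E v)) x)"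
      unfolding c S_pow_scale by (simp add: funpow_swap1)
    then show ?thesis
      using child.IH[of "Suc n"] K by (simp add: closed_subspace_iff)
  qed
  ultimately have "(S ^^ n) ?g + (S ^^ n) (ran_proj (basis_vec v)) \<in> K"
    using K unfolding closed_subspace_iff by blast
  then show ?case
    unfolding S_pow_add[symmetric] by simp
qed

text \<open>\<open>ran_proj\<close> is a linear contraction, so the vectors it sends into
  \<open>K\<close> form a closed subspace; basis vectors then suffice.\<close>

lemma ran_proj_in:
  assumes K: "closed_subspace V K" and NK: "(\<Union>n\<in>{1..}. (S ^^ n) ` N) \<subseteq> K"
    and f: "f \<in> l2 V"
  shows "ran_proj f \<in> K"
proof -
  let ?M = "{f \<in> l2 V. ran_proj f \<in> K}"
  have "?M = l2 V"
  proof (rule closed_subspace_eq_l2)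
    have "ran_proj 0 = 0"
      using ran_proj_scale[of 0 0] by (simp add: zero_fun_def)
    moreover have "g \<in> ?M"
      if g: "g \<in> l2 V" and approx: "\<forall>e>0. \<exists>h\<in>?M. l2_norm V (g - h) < e" for g
    proof -
      have "\<exists>k\<in>K. l2_norm V (ran_proj g - k) < e" if e: "e > 0" for e
      proof -
        obtain h where h: "h \<in> l2 V" "ran_proj h \<in> K" "l2_norm V (g - h) < e"
          using approx e by blast
        have gh: "g - h \<in> l2 V" using g h l2_diff by blast
        have "ran_proj g = ran_proj (g - h) + ran_proj h"
          using ran_proj_add[OF gh h(1)] by simp
        then have "l2_norm V (ran_proj g - ran_proj h) < e"
          using ran_proj_contraction(2)[OF gh] h(3) by simp
        with h show ?thesis by blast
      qed
      then show ?thesis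
        using K g ran_proj_contraction(1)[OF g] unfolding closed_subspace_iff by blast
    qed
    ultimately show "closed_subspace V ?M"
      unfolding closed_subspace_iff
      using K[unfolded closed_subspace_iff] by (simp add: l2_triangle l2_scale ran_proj_add ran_proj_scale)
  next
    fix v assume v: "v \<in> V"
    have "ran_proj (basis_vec v) \<in> K"
    proof (cases "v = tree_root V E")
      case True
      have "adj (basis_vec v) = 0"
        using basis_vec_root_N by (simp add: True N_iff)
      then have "ran_proj (basis_vec v) = S 0"
        unfolding ran_proj_def by (intro arg_cong[where f = S]) (simp add: fun_eq_iff)
      then show ?thesis
        using K by (simp only: S_0 closed_subspace_iff) 
    next
      case False
      then have v': "v \<in> nonroots V E"
        using v by (simp add: nonroots_def)
      obtain c where c: "ran_proj (basis_vec v) = (\<lambda>x. c * S (basis_vec (par E v)) x)"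
        using ran_proj_basis_vec[OF v'] .
      have "S (basis_vec (par E v)) \<in> K"
        using S_pow_basis_vec_in[OF K NK par_in[OF v'], of 1] by simp
      then show ?thesis
        using K unfolding c closed_subspace_iff by blast
    qed
    then show "basis_vec v \<in> ?M"
      using v by (simp add: basis_vec_l2)
  qed
  with f show ?thesis by blast
qed

lemma N_orthogonal_S_pow:
  assumes "f \<in> N" "g \<in> l2 V" "1 \<le> n"
  shows "l2_inner V f ((S ^^ n) g) = 0"
proof -
  obtain m where "n = Suc m" using \<open>1 \<le> n\<close> by (metis Suc_le_D One_nat_def)
  then show ?thesis
    using inner_N_S[of "(S ^^ m) g" f] assms by (simp add: S_pow_l2)
qed

text \<open>The orthogonal complement of \<open>N\<close> is closed and contains the generators,
  hence the closed span; \<open>ran_proj\<close> supplies the decomposition.\<close>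

lemma orthogonal_sum:
  "is_orthogonal_sum V (l2 V) N (closed_span V (\<Union>n\<in>{1..}. (S ^^ n) ` N))"
proof -
  let ?X = "\<Union>n\<in>{1..}. (S ^^ n) ` N"
  let ?K = "closed_span V ?X"
  have X: "?X \<subseteq> l2 V"
    using N_l2 S_pow_l2 by blast
  have K: "closed_subspace V ?K"
    using X by (rule closed_subspace_closed_span)
  have XK: "?X \<subseteq> ?K"
    unfolding closed_span_def by blast
  have N: "N \<subseteq> l2 V"
    using N_l2 by blast
  have "?K \<subseteq> {g \<in> l2 V. \<forall>f\<in>N. l2_inner V f g = 0}"
    by (rule closed_span_least[OF closed_subspace_orthogonal_complement[OF N]])
      (use X N_orthogonal_S_pow N_l2 in auto)
  then have "orthogonal_sets V N ?K"
    unfolding orthogonal_sets_def by blast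
  moreover have "l2 V = {f + g |f g. f \<in> N \<and> g \<in> ?K}"
  proof
    show "l2 V \<subseteq> {f + g |f g. f \<in> N \<and> g \<in> ?K}"
    proof
      fix f assume f: "f \<in> l2 V"
      have "f = (f - ran_proj f) + ran_proj f" by simp
      then show "f \<in> {f + g |f g. f \<in> N \<and> g \<in> ?K}"
        using diff_ran_proj_N[OF f] ran_proj_in[OF K XK f] by blast
    qed
    show "{f + g |f g. f \<in> N \<and> g \<in> ?K} \<subseteq> l2 V"
      using N K l2_triangle(1) unfolding closed_subspace_iff by blast
  qed
  ultimately show ?thesis
    unfolding is_orthogonal_sum_def using K closed_subspace_N by blast
qed

section \<open>Trivial intersections for injective shifts\<close>

lemma S_pow_inj:
  assumes "inj_on S (l2 V)"
  shows "inj_on (S ^^ n) (l2 V)"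
proof (induction n)
  case (Suc n)
  show ?case
  proof (rule inj_onI)
    fix f g assume fg: "f \<in> l2 V" "g \<in> l2 V" "(S ^^ Suc n) f = (S ^^ Suc n) g"
    then have "(S ^^ n) f = (S ^^ n) g"
      using assms S_pow_l2 by (auto dest: inj_onD)
    with fg Suc show "f = g" by (auto dest: inj_onD)
  qed
qed simp

text \<open>Injectivity cancels the smaller power, so the common vector comes from an element of
  \<open>N\<close> that also lies in the range of \<open>S\<close> and is therefore orthogonal to
  itself.\<close>

lemma S_pow_N_disjoint:
  assumes inj: "inj_on S (l2 V)" and "n \<noteq> m"
  shows "(S ^^ n) ` N \<inter> (S ^^ m) ` N = {0}"
proof -
  have *: "f = 0" if nm: "n < m" and f: "f \<in> (S ^^ n) ` N" "f \<in> (S ^^ m) ` N" for n m f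
  proof -
    obtain g h where g: "g \<in> N" "f = (S ^^ n) g" and h: "h \<in> N" "f = (S ^^ m) h"
      using f by blast
    have "(S ^^ m) h = (S ^^ n) ((S ^^ (m - n)) h)"
      using funpow_add[of n "m - n" S] nm by simp
    then have eq: "g = (S ^^ (m - n)) h"
      using g h inj_onD[OF S_pow_inj[OF inj, of n], of g "(S ^^ (m - n)) h"] N_l2 S_pow_l2 by metis
    have "l2_inner V g ((S ^^ (m - n)) h) = 0"
      using N_orthogonal_S_pow[OF g(1) N_l2[OF h(1)], of "m - n"] nm by simp
    then have "g = 0"
      using l2_inner_self_eq_0[OF N_l2[OF g(1)]] eq by simp
    then show ?thesis
      using g S_pow_0 by simp
  qed
  have "f = 0" if "f \<in> (S ^^ n) ` N" "f \<in> (S ^^ m) ` N" for f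
    using *[of n m f] *[of m n f] that \<open>n \<noteq> m\<close> by linarith
  moreover have "0 \<in> (S ^^ k) ` N" for k
    using N_0 S_pow_0[of k] by (metis imageI)
  ultimately show ?thesis by blast
qed

section \<open>The diagonal entries attached to the powers of the shift\<close>

text \<open>This is \<open>\<parallel>S\<^sup>n e\<^sub>u\<parallel>\<^sup>2\<close>.\<close>

primrec sq_norm :: "nat \<Rightarrow> 'a \<Rightarrow> real" where
  "sq_norm 0 u = 1"
| "sq_norm (Suc n) u = (\<Sum>\<^sub>\<infinity>v\<in>chi u. sq_norm n v * (lam v)\<^sup>2)"

lemma sq_norm_nonneg: "0 \<le> sq_norm n u"
  by (induction n arbitrary: u) (auto intro!: infsum_nonneg)

lemma chi_in: "v \<in> chi u \<Longrightarrow> v \<in> V"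
  using chi_subset nonroots_subset by blast

text \<open>The two facts are intertwined: the bound \<open>K\<close> at \<open>n\<close> gives
  summability by comparison with the squared weights, and this lets the sum at \<open>Suc n\<close>
  be estimated termwise by \<open>K * B\<close>.\<close>

lemma
  shows sq_norm_bound: "\<exists>K. \<forall>u\<in>V. sq_norm n u \<le> K"
    and sq_norm_summable: "u \<in> V \<Longrightarrow> (\<lambda>v. sq_norm n v * (lam v)\<^sup>2) summable_on chi u"
proof -
  have s: "(\<lambda>v. sq_norm n v * (lam v)\<^sup>2) summable_on chi u"
    if K: "\<forall>u\<in>V. sq_norm n u \<le> K" and u: "u \<in> V" for n K u
  proof (rule summable_on_comparison_test)
    show "(\<lambda>v. K * (lam v)\<^sup>2) summable_on chi u"
      by (intro summable_on_cmult_right lam_summable u)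
    show "sq_norm n v * (lam v)\<^sup>2 \<le> K * (lam v)\<^sup>2" if "v \<in> chi u" for v
      using K chi_in[OF that] by (intro mult_right_mono) auto
  qed (simp add: sq_norm_nonneg)
  show bd: "\<exists>K. \<forall>u\<in>V. sq_norm n u \<le> K" for n
  proof (induction n)
    case (Suc n)
    then obtain K where K: "\<forall>u\<in>V. sq_norm n u \<le> K" by blast
    \<comment> \<open>The root shows that \<open>K\<close> dominates some nonnegative entry.\<close>
    have K0: "0 \<le> K"
      using K tree_root_in sq_norm_nonneg[of n "tree_root V E"] by force
    obtain B where B: "\<And>u. u \<in> V \<Longrightarrow> (\<Sum>\<^sub>\<infinity>v\<in>chi u. (lam v)\<^sup>2) \<le> B"
      using ex_lam_bound by blast
    have "sq_norm (Suc n) u \<le> K * B" if u: "u \<in> V" for u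
    proof -
      have "sq_norm (Suc n) u \<le> (\<Sum>\<^sub>\<infinity>v\<in>chi u. K * (lam v)\<^sup>2)"
        unfolding sq_norm.simps
        using K chi_in lam_summable[OF u]
        by (intro infsum_mono s[OF K u] summable_on_cmult_right mult_right_mono) auto
      also have "\<dots> = K * (\<Sum>\<^sub>\<infinity>v\<in>chi u. (lam v)\<^sup>2)"
        by (rule infsum_cmult_right')
      also have "\<dots> \<le> K * B"
        using B[OF u] K0 by (rule mult_left_mono)
      finally show ?thesis .
    qed
    then show ?case by blast
  qed auto
  show "u \<in> V \<Longrightarrow> (\<lambda>v. sq_norm n v * (lam v)\<^sup>2) summable_on chi u"
    using bd[of n] s by blast
qed

text \<open>In other words, \<open>S\<^sup>*\<^sup>nS\<^sup>n\<close> is the diagonal operator with entries \<open>sq_norm n\<close>.\<close>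

lemma inner_S_pow:
  assumes "f \<in> l2 V" "g \<in> l2 V"
  shows "l2_inner V ((S ^^ n) f) ((S ^^ n) g) =
    (\<Sum>\<^sub>\<infinity>u\<in>V. of_real (sq_norm n u) * (f u * cnj (g u)))"
  using assms
proof (induction n arbitrary: f g)
  case 0
  then show ?case by (simp add: l2_inner_def)
next
  case (Suc n)
  obtain K where K: "\<forall>u\<in>V. sq_norm n u \<le> K"
    using sq_norm_bound by blast
  have "l2_inner V ((S ^^ Suc n) f) ((S ^^ Suc n) g) =
      l2_inner V ((S ^^ n) (S f)) ((S ^^ n) (S g))"
    by (simp add: funpow_swap1)
  also have "\<dots> = (\<Sum>\<^sub>\<infinity>v\<in>V. of_real (sq_norm n v) * (S f v * cnj (S g v)))"
    using Suc.prems by (intro Suc.IH S_l2)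
  also have "\<dots> = (\<Sum>\<^sub>\<infinity>u\<in>V. f u * (\<Sum>\<^sub>\<infinity>v\<in>chi u. of_real (sq_norm n v * lam v) * cnj (S g v)))"
    using K Suc.prems sq_norm_nonneg
    by (intro weighted_inner_S[where K = K] S_l2) (auto simp: abs_of_nonneg)
  \<comment> \<open>On \<open>chi u\<close>, \<open>S g\<close> contributes a second factor
    \<open>lam v\<close>, so the inner sum becomes the recursion for
    \<open>sq_norm (Suc n)\<close>.\<close>
  also have "\<dots> = (\<Sum>\<^sub>\<infinity>u\<in>V. of_real (sq_norm (Suc n) u) * (f u * cnj (g u)))"
  proof (rule infsum_cong)
    fix u assume u: "u \<in> V"
    have "(\<Sum>\<^sub>\<infinity>v\<in>chi u. of_real (sq_norm n v * lam v) * cnj (S g v)) =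
        (\<Sum>\<^sub>\<infinity>v\<in>chi u. of_real (sq_norm n v * (lam v)\<^sup>2) * cnj (g u))"
      by (rule infsum_cong) (simp add: S_chi power2_eq_square)
    also have "\<dots> = of_real (sq_norm (Suc n) u) * cnj (g u)"
      unfolding infsum_cmult_left' sq_norm.simps
        infsumI[OF has_sum_of_real[OF has_sum_infsum[OF sq_norm_summable[OF u]]]] by (rule refl)
    finally show "f u * (\<Sum>\<^sub>\<infinity>v\<in>chi u. of_real (sq_norm n v * lam v) * cnj (S g v)) =
        of_real (sq_norm (Suc n) u) * (f u * cnj (g u))"
      by (simp only: mult_ac)
  qed
  finally show ?case .
qed

lemma inner_S_pow_basis_vec:
  assumes u: "u \<in> V" and g: "g \<in> l2 V"
  shows "l2_inner V ((S ^^ n) (basis_vec u)) ((S ^^ n) g) = of_real (sq_norm n u) * cnj (g u)"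
proof -
  have "l2_inner V ((S ^^ n) (basis_vec u)) ((S ^^ n) g) =
      (\<Sum>\<^sub>\<infinity>v\<in>{u}. of_real (sq_norm n v) * cnj (g v))"
    unfolding inner_S_pow[OF basis_vec_l2[OF u] g]
    by (rule infsum_cong_neutral) (use u in \<open>auto simp: basis_vec_apply\<close>)
  then show ?thesis by simp
qed

lemma l2_norm_S_pow_basis_vec:
  assumes u: "u \<in> V"
  shows "(l2_norm V ((S ^^ n) (basis_vec u)))\<^sup>2 = sq_norm n u"
proof -
  have "of_real ((l2_norm V ((S ^^ n) (basis_vec u)))\<^sup>2) = (of_real (sq_norm n u) :: complex)"
    using inner_S_pow_basis_vec[OF u basis_vec_l2[OF u], of n]
      l2_inner_self[OF S_pow_l2[OF basis_vec_l2[OF u]], of n]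
    by (simp add: basis_vec_apply)
  then show ?thesis
    by (simp only: of_real_eq_iff)
qed

lemma l2_norm_S_pow_eq_iff:
  assumes "u \<in> V" "v \<in> V"
  shows "l2_norm V ((S ^^ n) (basis_vec u)) = l2_norm V ((S ^^ n) (basis_vec v)) \<longleftrightarrow>
    sq_norm n u = sq_norm n v"
  unfolding l2_norm_S_pow_basis_vec[OF assms(1), symmetric] l2_norm_S_pow_basis_vec[OF assms(2), symmetric]
  by simp

section \<open>From local power balance to orthogonality\<close>

lemma S_pow_N_orthogonal:
  assumes bal: "locally_power_balanced V E lam" and "n \<noteq> m"
  shows "orthogonal_sets V ((S ^^ n) ` N) ((S ^^ m) ` N)"
proof -
  have *: "l2_inner V ((S ^^ m) h) ((S ^^ n) g) = 0"
    if nm: "n < m" and g: "g \<in> N" and h: "h \<in> N" for n m g h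
  proof -
    \<comment> \<open>After matching \<open>n\<close> powers at least one \<open>S\<close> is left,
      so the vector paired with \<open>g\<close> in the diagonal form is \<open>S p\<close>.\<close>
    obtain k where k: "m = n + Suc k"
      using nm less_iff_Suc_add by (metis add_Suc_right)
    define p where "p = (S ^^ k) h"
    have p: "p \<in> l2 V"
      unfolding p_def using h by (intro S_pow_l2 N_l2)
    obtain K where K: "\<forall>u\<in>V. sq_norm n u \<le> K"
      using sq_norm_bound by blast
    \<comment> \<open>Balance speaks only of positive powers; for \<open>n = 0\<close> all entries
      are 1.\<close>
    have sibling: "sq_norm n v = sq_norm n w" if "v \<in> chi u" "w \<in> chi u" for u v w
    proof (cases "n = 0")
      case False
      then have "l2_norm V ((S ^^ n) (basis_vec v)) = l2_norm V ((S ^^ n) (basis_vec w))"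
        using bal that by (simp add: locally_power_balanced_def chi_def)
      then show ?thesis
        using l2_norm_S_pow_eq_iff[OF chi_in chi_in] that by blast
    qed simp
    have "l2_inner V ((S ^^ m) h) ((S ^^ n) g) = l2_inner V ((S ^^ n) (S p)) ((S ^^ n) g)"
      by (simp add: k p_def funpow_add funpow_swap1)
    also have "\<dots> = (\<Sum>\<^sub>\<infinity>v\<in>V. of_real (sq_norm n v) * (S p v * cnj (g v)))"
      using p N_l2[OF g] by (intro inner_S_pow S_l2)
    also have "\<dots> = (\<Sum>\<^sub>\<infinity>u\<in>V. p u * (\<Sum>\<^sub>\<infinity>v\<in>chi u. of_real (sq_norm n v * lam v) * cnj (g v)))"
      using K p sq_norm_nonneg N_l2[OF g]
      by (intro weighted_inner_S[where K = K]) (auto simp: abs_of_nonneg)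
    also have "\<dots> = 0"
    proof (rule infsum_0)
      fix u assume u: "u \<in> V"
      show "p u * (\<Sum>\<^sub>\<infinity>v\<in>chi u. of_real (sq_norm n v * lam v) * cnj (g v)) = 0"
      proof (cases "chi u = {}")
        case False
        then obtain w where w: "w \<in> chi u" by blast
        \<comment> \<open>The entry of one representative child comes out of the sum, and what
          remains is the conjugate of \<open>adj g u\<close>.\<close>
        have "(\<Sum>\<^sub>\<infinity>v\<in>chi u. of_real (sq_norm n v * lam v) * cnj (g v)) =
            (\<Sum>\<^sub>\<infinity>v\<in>chi u. of_real (sq_norm n w) * cnj (of_real (lam v) * g v))"
          by (rule infsum_cong) (simp add: sibling[OF _ w])
        also have "\<dots> = of_real (sq_norm n w) * cnj (adj g u)"
          unfolding infsum_cmult_right' infsum_cnj adj_def by (rule refl)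
        also have "adj g u = 0"
          using g by (simp add: N_iff)
        finally show ?thesis by simp
      qed simp
    qed
    finally show ?thesis .
  qed
  show ?thesis
    unfolding orthogonal_sets_def
  proof (intro ballI)
    fix a b assume "a \<in> (S ^^ n) ` N" "b \<in> (S ^^ m) ` N"
    then obtain g h where gh: "g \<in> N" "h \<in> N" "a = (S ^^ n) g" "b = (S ^^ m) h" by blast
    show "l2_inner V a b = 0"
    proof (cases "n < m")
      case True
      then show ?thesis
        using *[OF True gh(1,2)] l2_inner_cnj[of V a b] gh by simp
    next
      case False
      then have "m < n" using \<open>n \<noteq> m\<close> by simp
      then show ?thesis
        using *[OF _ gh(2,1)] gh by blast
    qed
  qed
qed

section \<open>From orthogonality to balance\<close>

text \<open>The value is the product of the weights along the path from the root to
  \<open>v\<close>. It yields test vectors that do not vanish at a given vertex.\<close>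

lemma S_pow_root_pos:
  assumes "v \<in> V"
  shows "\<exists>x>0. (S ^^ depth V E v) (basis_vec (tree_root V E)) v = of_real x"
  using assms
proof (induction v rule: tree_induct)
  case root
  then show ?case
    by (intro exI[of _ 1]) (simp add: depth_root basis_vec_apply)
next
  case (child v)
  then obtain x where x: "0 < x"
    "(S ^^ depth V E (par E v)) (basis_vec (tree_root V E)) (par E v) = of_real x"
    by blast
  have "(S ^^ depth V E v) (basis_vec (tree_root V E)) v = of_real (lam v * x)"
    using child.hyps x by (simp add: depth_child weighted_shift_def)
  moreover have "0 < lam v * x"
    using lam_pos child.hyps x by simp
  ultimately show ?case by blast
qed

text \<open>Test orthogonality on \<open>\<lambda>\<^sub>v e\<^sub>u - \<lambda>\<^sub>u e\<^sub>v \<in> N\<close> against the powers of \<open>S\<close> at \<open>e\<^bsub>root\<^esub> \<in> N\<close>.\<close>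

lemma orthogonal_imp_sibling_eq:
  assumes orth: "\<And>n m. n \<noteq> m \<Longrightarrow> orthogonal_sets V ((S ^^ n) ` N) ((S ^^ m) ` N)"
    and u: "u \<in> nonroots V E" and v: "v \<in> nonroots V E" and uv: "par E u = par E v"
  shows "sq_norm n u = sq_norm n v"
proof -
  let ?r = "basis_vec (tree_root V E)"
  let ?g = "(\<lambda>x. of_real (lam v) * basis_vec u x) + (\<lambda>x. - of_real (lam u) * basis_vec v x)"
  have uV: "u \<in> V" and vV: "v \<in> V"
    using u v nonroots_subset by auto
  have l2: "basis_vec u \<in> l2 V" "basis_vec v \<in> l2 V" "?r \<in> l2 V"
    using uV vV tree_root_in by (auto intro: basis_vec_l2)
  have "adj ?g = 0"
    unfolding adj_add[OF l2_scale[OF l2(1)] l2_scale[OF l2(2)]] adj_scale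
    by (auto simp: fun_eq_iff adj_basis_vec[OF u] adj_basis_vec[OF v] uv)
  then have g: "?g \<in> N"
    using l2 by (simp only: N_iff l2_triangle l2_scale simp_thms)
  obtain x where x: "0 < x" "(S ^^ depth V E (par E u)) ?r (par E u) = of_real x"
    using S_pow_root_pos[OF par_in[OF u]] by blast
  \<comment> \<open>\<open>k\<close> is the common depth of \<open>u\<close> and \<open>v\<close>;
    it is positive, so the powers \<open>n\<close> and \<open>n + k\<close> differ.\<close>
  define k where "k = Suc (depth V E (par E u))"
  have val: "(S ^^ k) ?r u = of_real (lam u * x)" "(S ^^ k) ?r v = of_real (lam v * x)"
    using x u v uv by (simp_all add: k_def weighted_shift_def)
  have kr: "(S ^^ k) ?r \<in> l2 V"
    using l2 by (intro S_pow_l2)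
  have "n \<noteq> n + k" by (simp add: k_def)
  then have "l2_inner V ((S ^^ n) ?g) ((S ^^ (n + k)) ?r) = 0"
    using orth g basis_vec_root_N unfolding orthogonal_sets_def by blast
  then have "l2_inner V ((S ^^ n) ?g) ((S ^^ n) ((S ^^ k) ?r)) = 0"
    by (simp only: funpow_add comp_apply)
  then have "of_real (lam v) * (of_real (sq_norm n u) * of_real (lam u * x)) -
      of_real (lam u) * (of_real (sq_norm n v) * of_real (lam v * x)) = (0 :: complex)"
    using l2 kr uV vV
    unfolding S_pow_add S_pow_scale
    by (simp only: l2_inner_add_left l2_scale S_pow_l2 l2_inner_scale_left inner_S_pow_basis_vec
      val complex_cnj_complex_of_real) simp
  then have "of_real (lam v * (sq_norm n u * (lam u * x)) - lam u * (sq_norm n v * (lam v * x))) =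
      (0 :: complex)"
    by simp
  then have "lam v * (sq_norm n u * (lam u * x)) = lam u * (sq_norm n v * (lam v * x))"
    by (simp only: of_real_eq_0_iff right_minus_eq)
  moreover have "lam u > 0" "lam v > 0"
    using lam_pos u v by auto
  ultimately show ?thesis
    using x(1) by simp
qed

lemma orthogonal_imp_balanced:
  assumes orth: "\<And>n m. n \<noteq> m \<Longrightarrow> orthogonal_sets V ((S ^^ n) ` N) ((S ^^ m) ` N)"
    and inj: "inj_on S (l2 V)"
  shows "balanced V E lam"
proof -
  \<comment> \<open>Injectivity excludes \<open>S (basis_vec u) = 0\<close>, so this factor can be
    cancelled at every vertex.\<close>
  have pos: "sq_norm 1 u \<noteq> 0" if u: "u \<in> V" for u
  proof
    assume "sq_norm 1 u = 0"
    then have "l2_norm V (S (basis_vec u)) = 0"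
      using l2_norm_S_pow_basis_vec[OF u, of 1] by simp
    then have "l2_inner V (S (basis_vec u)) (S (basis_vec u)) = 0"
      using l2_inner_self[OF S_l2[OF basis_vec_l2[OF u]]] by simp
    then have "S (basis_vec u) = S 0"
      using l2_inner_self_eq_0[OF S_l2[OF basis_vec_l2[OF u]]] S_0 by simp
    then have "basis_vec u = 0"
      by (rule inj_onD[OF inj _ basis_vec_l2[OF u] l2_zero])
    then have "basis_vec u u = 0" by simp
    then show False by (simp add: basis_vec_apply)
  qed
  have step: "sq_norm (Suc n) (par E v) = sq_norm 1 (par E v) * sq_norm n v"
    if v: "v \<in> nonroots V E" for n v
  proof -
    have "sq_norm n w = sq_norm n v" if "w \<in> chi (par E v)" for w
      using that v by (intro orthogonal_imp_sibling_eq[OF orth]) (auto simp: chi_def)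
    then have "sq_norm (Suc n) (par E v) = (\<Sum>\<^sub>\<infinity>w\<in>chi (par E v). sq_norm n v * (lam w)\<^sup>2)"
      unfolding sq_norm.simps by (intro infsum_cong) simp
    then show ?thesis
      by (simp add: infsum_cmult_right')
  qed
  \<comment> \<open>All \<open>n\<close> are treated at once because the entry \<open>n\<close> at a
    child is governed by the entry \<open>Suc n\<close> at its parent; balance itself is the case
    \<open>n = 1\<close>.\<close>
  have eq: "sq_norm n u = sq_norm n v" if "u \<in> V" "v \<in> V" "depth V E u = depth V E v" for n u v
    using that
  proof (induction u arbitrary: v n rule: tree_induct)
    case root
    then have "v = tree_root V E"
      using depth_child[of v] by (cases "v \<in> nonroots V E") (auto simp: depth_root nonroots_def)
    then show ?case by simp
  next
    case (child u)
    have "v \<noteq> tree_root V E"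
      using child.prems child.hyps by (auto simp: depth_root depth_child)
    then have v: "v \<in> nonroots V E"
      using child.prems by (simp add: nonroots_def)
    have "depth V E (par E u) = depth V E (par E v)"
      using child.prems child.hyps v by (simp add: depth_child)
    then have IH: "sq_norm k (par E u) = sq_norm k (par E v)" for k
      using child.IH par_in[OF v] by blast
    \<comment> \<open>By \<open>step\<close>, both sides are entries \<open>Suc n\<close> at the two
      parents; the induction hypothesis is used at \<open>Suc n\<close> and at
      \<open>1\<close>.\<close>
    have "sq_norm 1 (par E v) * sq_norm n u = sq_norm 1 (par E v) * sq_norm n v"
      using step[OF child.hyps, of n] step[OF v, of n] IH by metis
    then show ?case
      using pos[OF par_in[OF v]] by simp
  qed
  show ?thesis
    unfolding balanced_def
  proof (intro ballI impI)
    fix u v assume "u \<in> V" "v \<in> V" "depth V E u = depth V E v"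
    then show "l2_norm V (S (basis_vec u)) = l2_norm V (S (basis_vec v))"
      using l2_norm_S_pow_eq_iff[of u v 1] eq[of u v 1] by simp
  qed
qed

end

theorem theorem16:
  fixes V :: "'a set" and E :: "('a \<times> 'a) set" and lam :: "'a \<Rightarrow> real"
    and S :: "('a \<Rightarrow> complex) \<Rightarrow> 'a \<Rightarrow> complex" and N :: "('a \<Rightarrow> complex) set"
  defines "S \<equiv> weighted_shift V E lam"
    and "N \<equiv> l2_kernel V (l2_adjoint V S)"
  assumes "directed_tree V E" and "rooted V E"
    and "countable V" and "infinite V"
    and "\<forall>v\<in>nonroots V E. 0 < lam v"
    and "bounded_operator V S"
  shows
    "is_orthogonal_sum V (l2 V) N (closed_span V (\<Union>n\<in>{1..}. (S ^^ n) ` N)) \<and>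
     (inj_on S (l2 V) \<longrightarrow>
        (\<forall>n m. n \<noteq> m \<longrightarrow> (S ^^ n) ` N \<inter> (S ^^ m) ` N = {0})) \<and>
     (locally_power_balanced V E lam \<longrightarrow>
        (\<forall>n m. n \<noteq> m \<longrightarrow> orthogonal_sets V ((S ^^ n) ` N) ((S ^^ m) ` N))) \<and>
     ((\<forall>n m. n \<noteq> m \<longrightarrow> orthogonal_sets V ((S ^^ n) ` N) ((S ^^ m) ` N)) \<and>
        inj_on S (l2 V) \<longrightarrow> balanced V E lam)"
proof -
  interpret tree_shift V E lam
    using assms(3,4,7,8) unfolding S_def by unfold_locales
  show ?thesis
    unfolding N_def S_def
    using orthogonal_sum S_pow_N_disjoint S_pow_N_orthogonal orthogonal_imp_balanced by blast
qed

end
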